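(* Let $\alpha\ge0$ be an integer and $\nu\in\mathbb{C}$. Let $\widetilde{\mathbb{O}}[\alpha;\nu]$ be the associative algebra over $\mathbb{C}$, with unit $A(1)$, given by generators $A(g)$, $g\in S_\alpha$, and $\Theta_1,\dots,\Theta_\alpha$, and relations (for all $g,g_1,g_2\in S_\alpha$ and all $i,j\in\{1,\dots,\alpha\}$, with $i\ne j$ in the last two) $$A(g_1)A(g_2)=A(g_1g_2);$$ $$A(g)\Theta_iA(g^{-1})=\Theta_{g(i)};$$ $$\Theta_j^2=(\nu-1)\Theta_j+\nu A(1);$$ $$\Theta_j\Theta_i-\Theta_i\Theta_j=A((ij))\,(\Theta_j-\Theta_i);$$ $$\bigl(A((ij))-A(1)\bigr)\,\Theta_j\,(\Theta_i+A(1))=0.$$ Then the map $\Theta_i\mapsto\theta_i$, $A(g)\mapsto\Xi(g)$ defined on the generators determines an isomorphism of algebras $\widetilde{\mathbb{O}}[\alpha;\nu]\to\mathbb{O}[\alpha;\nu]$.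
   Context: $\Omega_\alpha=\{1,\dots,\alpha\}$; $S_\alpha$ is its permutation group, $(ij)$ the transposition of $i$ and $j$. $\mathrm{PB}(\alpha)$ is the semigroup of all partial bijections of $\Omega_\alpha$, i.e. bijections $\sigma$ from a subset $\operatorname{dom}\sigma\subset\Omega_\alpha$ onto a subset $\operatorname{im}\sigma\subset\Omega_\alpha$, with product $\operatorname{dom}\sigma\tau=\{a\in\operatorname{dom}\tau:\tau(a)\in\operatorname{dom}\sigma\}$, $(\sigma\tau)(a)=\sigma(\tau(a))$; $\operatorname{rk}\sigma=\#\operatorname{dom}\sigma$; $S_\alpha\subset\mathrm{PB}(\alpha)$ is its group of invertible elements. $\kappa$ is an extension of $\phi$ if $\operatorname{dom}\kappa\supset\operatorname{dom}\phi$ and $\kappa|_{\operatorname{dom}\phi}=\phi$. $\mathbb{O}[\alpha;\nu]$ is the associative algebra over $\mathbb{C}$ with basis $\Xi(\sigma)$, $\sigma\in\mathrm{PB}(\alpha)$, and product $\Xi(\sigma)\Xi(\tau)=\sum_\kappa\mathfrak{c}^\kappa_{\sigma,\tau}(\nu)\Xi(\kappa)$, where $\mathfrak{c}^\kappa_{\sigma,\tau}(\nu)=\prod_{m=0}^{l-1}(\nu-\alpha+\operatorname{rk}\kappa-m)$ with $l=\alpha+\operatorname{rk}\sigma\tau-\operatorname{rk}\sigma-\operatorname{rk}\tau\ge0$ if $\kappa$ is an extension of $\sigma\tau$ with $\operatorname{dom}\kappa\cap\operatorname{dom}\tau=\operatorname{dom}\sigma\tau$ and $\operatorname{im}\kappa\cap\operatorname{im}\sigma=\operatorname{im}\sigma\tau$,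 and $\mathfrak{c}^\kappa_{\sigma,\tau}(\nu)=0$ otherwise. Its unit is $\Xi(1)$, $1$ the identity map. For $i\le\alpha$, $\theta_i:=\Xi(T_i)\in\mathbb{O}[\alpha;\nu]$, where $T_i\in\mathrm{PB}(\alpha)$ is the identity map of $\Omega_\alpha\setminus\{i\}$. *)

theory Defs
  imports
    Complex_Main
    "HOL-Library.Poly_Mapping"
    "HOL-Combinatorics.Permutations"
    "HOL-Algebra.QuotRing"
    "HOL-Algebra.Module"
begin

section \<open>Unital associative complex algebras as records\<close>

text \<open>
  The locale \<^locale>\<open>algebra\<close> of HOL-Algebra is about commutative algebras, so only the record
  type with fields for a ring and a scalar multiplication is used here. An isomorphism is a
  bijective unital homomorphism of rings (\<^const>\<open>ring_iso\<close>) that is linear.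
\<close>

type_synonym 'a calg = "(complex, 'a) module"

definition alg_hom :: "'a calg \<Rightarrow> 'b calg \<Rightarrow> ('a \<Rightarrow> 'b) set" where
  "alg_hom R S = {h \<in> ring_hom R S. \<forall>c. \<forall>x \<in> carrier R. h (c \<odot>\<^bsub>R\<^esub> x) = c \<odot>\<^bsub>S\<^esub> h x}"

definition alg_iso :: "'a calg \<Rightarrow> 'b calg \<Rightarrow> ('a \<Rightarrow> 'b) set" where
  "alg_iso R S = alg_hom R S \<inter> ring_iso R S"

definition quot_alg :: "'a calg \<Rightarrow> 'a set \<Rightarrow> 'a set calg" where
  "quot_alg R I = ring.extend (R Quot I)
     (module.fields (\<lambda>c X. \<Union>x\<in>X. I +>\<^bsub>R\<^esub> (c \<odot>\<^bsub>R\<^esub> x)))"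

definition scal :: "complex \<Rightarrow> ('b \<Rightarrow>\<^sub>0 complex) \<Rightarrow> ('b \<Rightarrow>\<^sub>0 complex)" where
  "scal c p = Poly_Mapping.map ((*) c) p"


section \<open>Free associative algebras\<close>

text \<open>
  The free monoid is wrapped in a type of its own and written additively, so that the convolution
  product of finitely supported functions from it to \<open>complex\<close> is the product of the free associative algebra.
\<close>

datatype 'g word = Word (letters: "'g list")

instantiation word :: (type) monoid_add
begin

definition "0 = Word []"
definition "u + v = Word (letters u @ letters v)"

instance
  by standard (simp_all add: zero_word_def plus_word_def)

end

definition free_alg :: "'g set \<Rightarrow> ('g word \<Rightarrow>\<^sub>0 complex) calg" where
  "free_alg G =
     \<lparr>carrier = {p. \<forall>w \<in> Poly_Mapping.keys p. set (letters w) \<subseteq> G},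
      mult = (*), one = 1, zero = 0, add = (+), smult = scal\<rparr>"

definition free_gen :: "'g \<Rightarrow> ('g word \<Rightarrow>\<^sub>0 complex)" where
  "free_gen x = Poly_Mapping.single (Word [x]) 1"

text \<open>
  \<^const>\<open>genideal\<close> is an intersection over all two-sided ideals, and being an ideal of a structure
  includes that the structure is a ring; this fact ensures that the intersection is the intended one.
\<close>

lemma ring_free_alg: "ring (free_alg G)"
proof -
  define C :: "('a word \<Rightarrow>\<^sub>0 complex) set"
    where "C = {p. \<forall>w \<in> Poly_Mapping.keys p. set (letters w) \<subseteq> G}"
  have C_mult: "p * q \<in> C" if pq: "p \<in> C" "q \<in> C" for p q
  proof -
    have "set (letters w) \<subseteq> G" if w: "w \<in> Poly_Mapping.keys (p * q)" for w
    proof -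
      obtain u v where "w = u + v" "u \<in> Poly_Mapping.keys p" "v \<in> Poly_Mapping.keys q"
        using keys_mult[of p q] w by blast
      then show ?thesis
        using pq by (simp add: C_def plus_word_def)
    qed
    then show ?thesis
      by (simp add: C_def)
  qed
  have C_add: "p + q \<in> C" if "p \<in> C" "q \<in> C" for p q
    using that Poly_Mapping.keys_add[of p q] unfolding C_def by blast
  have C_minus: "- p \<in> C" if "p \<in> C" for p
    using that by (simp add: C_def)
  have C_0: "0 \<in> C" and C_1: "1 \<in> C"
    by (simp_all add: C_def zero_word_def)
  have *: "carrier (free_alg G) = C" "monoid.mult (free_alg G) = (*)" "monoid.one (free_alg G) = 1"
    "ring.zero (free_alg G) = 0" "ring.add (free_alg G) = (+)"
    by (simp_all add: free_alg_def C_def)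
  show ?thesis
  proof (intro ringI abelian_groupI monoidI, unfold *)
    show "\<exists>q\<in>C. q + p = 0" if "p \<in> C" for p
      using C_minus[OF that] by (intro bexI[of _ "- p"]) simp_all
  qed (simp_all add: C_mult C_add C_0 C_1 algebra_simps)
qed


section \<open>Partial bijections\<close>

type_synonym pbij = "nat \<Rightarrow> nat option"

definition Om :: "nat \<Rightarrow> nat set" where
  "Om \<alpha> = {1..\<alpha>}"

definition PB :: "nat \<Rightarrow> pbij set" where
  "PB \<alpha> = {\<sigma>. dom \<sigma> \<subseteq> Om \<alpha> \<and> ran \<sigma> \<subseteq> Om \<alpha> \<and> inj_on \<sigma> (dom \<sigma>)}"

definition rk :: "pbij \<Rightarrow> nat" where
  "rk \<sigma> = card (dom \<sigma>)"

definition perm_pb :: "nat \<Rightarrow> (nat \<Rightarrow> nat) \<Rightarrow> pbij" where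
  "perm_pb \<alpha> g = (Some \<circ> g) |` Om \<alpha>"

definition T :: "nat \<Rightarrow> nat \<Rightarrow> pbij" where
  "T \<alpha> i = Some |` (Om \<alpha> - {i})"


section \<open>The algebra with basis \<open>PB(\<alpha>)\<close>\<close>

text \<open>
  The product of partial bijections is \<^const>\<open>map_comp\<close>. For \<open>\<sigma>, \<tau> \<in> PB \<alpha>\<close> the subtraction of
  natural numbers that gives the number of factors does not truncate.
\<close>

definition struct_const :: "nat \<Rightarrow> complex \<Rightarrow> pbij \<Rightarrow> pbij \<Rightarrow> pbij \<Rightarrow> complex" where
  "struct_const \<alpha> \<nu> \<kappa> \<sigma> \<tau> =
     (if \<sigma> \<circ>\<^sub>m \<tau> \<subseteq>\<^sub>m \<kappa> \<and> dom \<kappa> \<inter> dom \<tau> = dom (\<sigma> \<circ>\<^sub>m \<tau>) \<and> ran \<kappa> \<inter> ran \<sigma> = ran (\<sigma> \<circ>\<^sub>m \<tau>)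
      then \<Prod>m < \<alpha> + rk (\<sigma> \<circ>\<^sub>m \<tau>) - rk \<sigma> - rk \<tau>.
             \<nu> - of_nat \<alpha> + of_nat (rk \<kappa>) - of_nat m
      else 0)"

definition Xi :: "pbij \<Rightarrow> (pbij \<Rightarrow>\<^sub>0 complex)" where
  "Xi \<sigma> = Poly_Mapping.single \<sigma> 1"

definition O_mult ::
    "nat \<Rightarrow> complex \<Rightarrow> (pbij \<Rightarrow>\<^sub>0 complex) \<Rightarrow> (pbij \<Rightarrow>\<^sub>0 complex) \<Rightarrow> (pbij \<Rightarrow>\<^sub>0 complex)" where
  "O_mult \<alpha> \<nu> p q =
     (\<Sum>\<sigma>\<in>Poly_Mapping.keys p. \<Sum>\<tau>\<in>Poly_Mapping.keys q.
        scal (Poly_Mapping.lookup p \<sigma> * Poly_Mapping.lookup q \<tau>)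
          (\<Sum>\<kappa>\<in>PB \<alpha>. scal (struct_const \<alpha> \<nu> \<kappa> \<sigma> \<tau>) (Xi \<kappa>)))"

definition O_alg :: "nat \<Rightarrow> complex \<Rightarrow> (pbij \<Rightarrow>\<^sub>0 complex) calg" where
  "O_alg \<alpha> \<nu> =
     \<lparr>carrier = {p. Poly_Mapping.keys p \<subseteq> PB \<alpha>},
      mult = O_mult \<alpha> \<nu>, one = Xi (perm_pb \<alpha> id), zero = 0, add = (+), smult = scal\<rparr>"

definition theta :: "nat \<Rightarrow> nat \<Rightarrow> (pbij \<Rightarrow>\<^sub>0 complex)" where
  "theta \<alpha> i = Xi (T \<alpha> i)"


section \<open>The algebra given by generators and relations\<close>

datatype gen = Gen_A "nat \<Rightarrow> nat" | Gen_Theta nat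

definition gens :: "nat \<Rightarrow> gen set" where
  "gens \<alpha> = Gen_A ` {g. g permutes Om \<alpha>} \<union> Gen_Theta ` Om \<alpha>"

abbreviation fA :: "(nat \<Rightarrow> nat) \<Rightarrow> (gen word \<Rightarrow>\<^sub>0 complex)" where
  "fA g \<equiv> free_gen (Gen_A g)"

abbreviation fTheta :: "nat \<Rightarrow> (gen word \<Rightarrow>\<^sub>0 complex)" where
  "fTheta i \<equiv> free_gen (Gen_Theta i)"

text \<open>
  Each relation is listed as the difference of its two sides. The first one says that \<open>A(1)\<close> is
  the unit of the algebra.
\<close>

definition rels :: "nat \<Rightarrow> complex \<Rightarrow> (gen word \<Rightarrow>\<^sub>0 complex) set" where
  "rels \<alpha> \<nu> =
     {fA id - 1} \<union>
     {fA g\<^sub>1 * fA g\<^sub>2 - fA (g\<^sub>1 \<circ> g\<^sub>2) | g\<^sub>1 g\<^sub>2. g\<^sub>1 permutes Om \<alpha> \<and> g\<^sub>2 permutes Om \<alpha>} \<union>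
     {fA g * fTheta i * fA (inv_into UNIV g) - fTheta (g i) | g i. g permutes Om \<alpha> \<and> i \<in> Om \<alpha>} \<union>
     {fTheta j * fTheta j - (scal (\<nu> - 1) (fTheta j) + scal \<nu> (fA id)) | j. j \<in> Om \<alpha>} \<union>
     {(fTheta j * fTheta i - fTheta i * fTheta j) - fA (Transposition.transpose i j) * (fTheta j - fTheta i)
        | i j. i \<in> Om \<alpha> \<and> j \<in> Om \<alpha> \<and> i \<noteq> j} \<union>
     {(fA (Transposition.transpose i j) - fA id) * fTheta j * (fTheta i + fA id)
        | i j. i \<in> Om \<alpha> \<and> j \<in> Om \<alpha> \<and> i \<noteq> j}"

definition rel_ideal :: "nat \<Rightarrow> complex \<Rightarrow> (gen word \<Rightarrow>\<^sub>0 complex) set" where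
  "rel_ideal \<alpha> \<nu> = genideal (free_alg (gens \<alpha>)) (rels \<alpha> \<nu>)"

definition Ot_alg :: "nat \<Rightarrow> complex \<Rightarrow> (gen word \<Rightarrow>\<^sub>0 complex) set calg" where
  "Ot_alg \<alpha> \<nu> = quot_alg (free_alg (gens \<alpha>)) (rel_ideal \<alpha> \<nu>)"

definition A_gen :: "nat \<Rightarrow> complex \<Rightarrow> (nat \<Rightarrow> nat) \<Rightarrow> (gen word \<Rightarrow>\<^sub>0 complex) set" where
  "A_gen \<alpha> \<nu> g = rel_ideal \<alpha> \<nu> +>\<^bsub>free_alg (gens \<alpha>)\<^esub> fA g"

definition Theta_gen :: "nat \<Rightarrow> complex \<Rightarrow> nat \<Rightarrow> (gen word \<Rightarrow>\<^sub>0 complex) set" where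
  "Theta_gen \<alpha> \<nu> i = rel_ideal \<alpha> \<nu> +>\<^bsub>free_alg (gens \<alpha>)\<^esub> fTheta i"

definition maps_gens ::
    "nat \<Rightarrow> complex \<Rightarrow> ((gen word \<Rightarrow>\<^sub>0 complex) set \<Rightarrow> (pbij \<Rightarrow>\<^sub>0 complex)) \<Rightarrow> bool" where
  "maps_gens \<alpha> \<nu> \<phi> \<longleftrightarrow>
     (\<forall>g. g permutes Om \<alpha> \<longrightarrow> \<phi> (A_gen \<alpha> \<nu> g) = Xi (perm_pb \<alpha> g)) \<and>
     (\<forall>i\<in>Om \<alpha>. \<phi> (Theta_gen \<alpha> \<nu> i) = theta \<alpha> i)"

end

theory Submission
  imports Defs "HOL-Computational_Algebra.Polynomial"
begin

text \<open>
  \<^bold>\<open>Associativity.\<close> For a natural number \<open>n\<close> let \<open>X\<close> be the set of injective maps from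
  \<open>Om \<alpha>\<close> to an \<open>n\<close>-element set. The symmetric group of degree \<open>n\<close> acts on \<open>X \<times> X\<close>, and the orbit of
  \<open>(x, y)\<close> is given by the partial bijection \<open>\<sigma>\<close> with \<open>\<sigma> j = i\<close> iff \<open>x i = y j\<close>. Sending \<open>Xi \<sigma>\<close> to
  the 0-1 matrix of its orbit turns the product of \<^const>\<open>O_alg\<close> at the parameter \<open>\<nu> = n - \<alpha>\<close> into the
  product of matrices: an entry of a product counts the maps \<open>y\<close> in given relative positions to \<open>x\<close>
  and \<open>z\<close>, such a \<open>y\<close> is forced on \<open>dom \<sigma> \<union> ran \<tau>\<close> and free and injective outside, and the number
  of choices is the falling factorial in \<^const>\<open>struct_const\<close> (\<open>card_intermediate\<close>). If
  \<open>n \<ge> 2\<alpha>\<close>, every partial bijection occurs as a relative position, so the associativity of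
  matrix multiplication gives the identities between structure constants that express associativity.
  Both sides of these identities are polynomials in \<open>\<nu>\<close> which then agree at infinitely many points
  (\<open>struct_const_assoc\<close>).

  \<^bold>\<open>The homomorphism.\<close> The defining relations follow from a few explicit products in
  \<^const>\<open>O_alg\<close>, so the evaluation \<open>free_hom\<close> of the free algebra kills \<^const>\<open>rel_ideal\<close>. It remains to see that
  it is onto and that its kernel is not larger than this ideal.

  \<^bold>\<open>Spanning.\<close> Modulo the relations every element of the free algebra is a combination of monomials
  \<open>A(g) \<Theta>\<^sub>i \<dots> \<Theta>\<^sub>j\<close>. Modulo monomials with fewer factors \<open>\<Theta>\<close>, the factors commute, a repeated factor
  makes the monomial vanish, and a factor \<open>A(h)\<close> in front of the \<open>\<Theta>\<close> can be dropped if \<open>h\<close> only moves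
  indices that occur; these are the last three relations. So the leading part depends only on the set \<open>J\<close>
  of the indices and on the restriction of \<open>g\<close> to the complement of \<open>J\<close>, that is, on a partial
  bijection. By induction on the number of factors, one \<^emph>\<open>standard monomial\<close> for each partial
  bijection suffices (\<open>free_carrier_std_span\<close>).

  \<^bold>\<open>Independence.\<close> The standard monomial of \<open>\<sigma>\<close> is mapped to \<open>Xi \<sigma>\<close> plus a combination of elements \<open>Xi \<kappa>\<close> of
  larger rank (\<open>free_hom_std_monomial\<close>). By triangularity the images of the standard monomials form a basis of
  \<^const>\<open>O_alg\<close>. This yields surjectivity, and it shows that a combination of standard monomials in the kernel is zero.
\<close>

section \<open>Partial bijections\<close>

lemma finite_Om [simp]: "finite (Om \<alpha>)"
  and card_Om [simp]: "card (Om \<alpha>) = \<alpha>"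
  by (simp_all add: Om_def)

lemma PB_OmD:
  assumes "\<sigma> \<in> PB \<alpha>" "\<sigma> j = Some i"
  shows "j \<in> Om \<alpha>" "i \<in> Om \<alpha>"
  using assms by (auto simp: PB_def dom_def ran_def)

lemma PB_injD: "\<sigma> \<in> PB \<alpha> \<Longrightarrow> \<sigma> j = Some i \<Longrightarrow> \<sigma> j' = Some i \<Longrightarrow> j = j'"
  by (auto simp: PB_def inj_on_def dom_def)

lemma PB_I:
  assumes "\<And>j i. \<sigma> j = Some i \<Longrightarrow> j \<in> Om \<alpha> \<and> i \<in> Om \<alpha>"
    and "\<And>j j' i. \<sigma> j = Some i \<Longrightarrow> \<sigma> j' = Some i \<Longrightarrow> j = j'"
  shows "\<sigma> \<in> PB \<alpha>"
  using assms by (fastforce simp: PB_def inj_on_def dom_def ran_def)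

lemma map_eq_iff_Some: "\<sigma> = \<tau> \<longleftrightarrow> (\<forall>j i. \<sigma> j = Some i \<longleftrightarrow> \<tau> j = Some i)"
  by (metis ext not_Some_eq)

lemma finite_dom_PB: "\<sigma> \<in> PB \<alpha> \<Longrightarrow> finite (dom \<sigma>)"
  by (auto simp: PB_def intro: finite_subset[OF _ finite_Om])

lemma finite_ran_PB: "\<sigma> \<in> PB \<alpha> \<Longrightarrow> finite (ran \<sigma>)"
  by (auto simp: PB_def intro: finite_subset[OF _ finite_Om])

lemma finite_PB [simp]: "finite (PB \<alpha>)"
proof -
  have "PB \<alpha> \<subseteq> (\<Union>A\<in>Pow (Om \<alpha>). {\<sigma>. dom \<sigma> = A \<and> ran \<sigma> \<subseteq> Om \<alpha>})"
    by (auto simp: PB_def)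
  moreover have "finite {\<sigma>. dom \<sigma> = A \<and> ran \<sigma> \<subseteq> Om \<alpha>}" if "A \<in> Pow (Om \<alpha>)" for A
    using that by (intro finite_set_of_finite_maps) (auto intro: finite_subset[OF _ finite_Om])
  ultimately show ?thesis
    by (meson finite_Om finite_Pow_iff finite_UN_I finite_subset)
qed

lemma card_ran_eq_rk:
  assumes "\<sigma> \<in> PB \<alpha>"
  shows "card (ran \<sigma>) = rk \<sigma>"
proof -
  have "ran \<sigma> = (the \<circ> \<sigma>) ` dom \<sigma>"
    by (force simp: ran_def dom_def image_iff)
  moreover have "inj_on (the \<circ> \<sigma>) (dom \<sigma>)"
    using assms by (auto simp: PB_def inj_on_def dom_def)
  ultimately show ?thesis
    by (simp only: rk_def card_image)
qed

lemma rk_le: "\<sigma> \<in> PB \<alpha> \<Longrightarrow> rk \<sigma> \<le> \<alpha>"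
  using card_mono[OF finite_Om, of "dom \<sigma>" \<alpha>] by (simp add: PB_def rk_def)

lemma map_comp_PB: "\<sigma> \<in> PB \<alpha> \<Longrightarrow> \<tau> \<in> PB \<alpha> \<Longrightarrow> \<sigma> \<circ>\<^sub>m \<tau> \<in> PB \<alpha>"
  by (rule PB_I) (auto simp: map_comp_Some_iff dest: PB_OmD PB_injD)

lemma card_dom_Int_ran:
  assumes "\<sigma> \<in> PB \<alpha>" "\<tau> \<in> PB \<alpha>"
  shows "card (dom \<sigma> \<inter> ran \<tau>) = rk (\<sigma> \<circ>\<^sub>m \<tau>)"
proof -
  let ?\<rho> = "\<tau> |` dom (\<sigma> \<circ>\<^sub>m \<tau>)"
  have "?\<rho> \<in> PB \<alpha>"
    using assms by (intro PB_I) (auto simp: restrict_map_def split: if_splits dest: PB_OmD PB_injD)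
  moreover have "ran ?\<rho> = dom \<sigma> \<inter> ran \<tau>"
    by (force simp: ran_def restrict_map_def map_comp_Some_iff dom_def split: if_splits)
  moreover have "dom ?\<rho> = dom (\<sigma> \<circ>\<^sub>m \<tau>)"
    by (auto simp: map_comp_Some_iff)
  ultimately show ?thesis
    using card_ran_eq_rk[of ?\<rho>] by (simp add: rk_def)
qed

text \<open>
  Consequently the number of factors in \<^const>\<open>struct_const\<close> is the number of elements of \<open>Om \<alpha>\<close> outside
  \<open>dom \<sigma> \<union> ran \<tau>\<close>. It is stated with sums to avoid the truncated subtraction.
\<close>

lemma card_dom_Un_ran:
  assumes "\<sigma> \<in> PB \<alpha>" "\<tau> \<in> PB \<alpha>"
  shows "card (dom \<sigma> \<union> ran \<tau>) + rk (\<sigma> \<circ>\<^sub>m \<tau>) = rk \<sigma> + rk \<tau>"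
  using card_Un_Int[of "dom \<sigma>" "ran \<tau>"] card_dom_Int_ran[OF assms] card_ran_eq_rk[OF assms(2)]
    finite_dom_PB[OF assms(1)] finite_ran_PB[OF assms(2)]
  by (simp add: rk_def)

section \<open>Relative positions of injective maps\<close>

definition inj_maps :: "nat \<Rightarrow> nat \<Rightarrow> (nat \<Rightarrow> nat) set" where
  "inj_maps \<alpha> n = {x \<in> Om \<alpha> \<rightarrow>\<^sub>E {1..n}. inj_on x (Om \<alpha>)}"

text \<open>
  The relative position of \<open>x\<close> and \<open>y\<close>: it records which values of \<open>x\<close> and \<open>y\<close> coincide. It is written as a map
  from indices of \<open>y\<close> to indices of \<open>x\<close>, so that relative positions compose in the same order as partial bijections.
\<close>

definition coinc :: "nat \<Rightarrow> (nat \<Rightarrow> nat) \<Rightarrow> (nat \<Rightarrow> nat) \<Rightarrow> pbij" where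
  "coinc \<alpha> x y = (\<lambda>j. if j \<in> Om \<alpha> \<and> y j \<in> x ` Om \<alpha> then Some (inv_into (Om \<alpha>) x (y j)) else None)"

lemma finite_inj_maps [simp]: "finite (inj_maps \<alpha> n)"
  unfolding inj_maps_def by (rule finite_subset[OF _ finite_PiE[of "Om \<alpha>" "\<lambda>_. {1..n}"]]) auto

lemma coinc_iff:
  assumes "inj_on x (Om \<alpha>)"
  shows "coinc \<alpha> x y j = Some i \<longleftrightarrow> i \<in> Om \<alpha> \<and> j \<in> Om \<alpha> \<and> x i = y j"
proof -
  have "inv_into (Om \<alpha>) x (x i) = i" if "i \<in> Om \<alpha>" for i
    using assms that by (rule inv_into_f_f)
  then show ?thesis
    by (auto simp: coinc_def) (metis imageI)+
qed

lemma coinc_PB: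
  assumes "inj_on x (Om \<alpha>)" "inj_on y (Om \<alpha>)"
  shows "coinc \<alpha> x y \<in> PB \<alpha>"
  using assms by (intro PB_I) (auto simp: coinc_iff inj_on_def)

text \<open>
  The condition on \<open>\<kappa>\<close> in \<^const>\<open>struct_const\<close>. In terms of injective maps \<open>x\<close>, \<open>y\<close>, \<open>z\<close> whose pairwise
  relative positions are \<open>\<sigma>\<close>, \<open>\<tau>\<close> and \<open>\<kappa>\<close>, it says that any two of the equalities \<open>x i = y j\<close>, \<open>y j = z k\<close>,
  \<open>x i = z k\<close> imply the third. The next four lemmas express it in this form.
\<close>

definition admissible :: "pbij \<Rightarrow> pbij \<Rightarrow> pbij \<Rightarrow> bool" where
  "admissible \<kappa> \<sigma> \<tau> \<longleftrightarrow> \<sigma> \<circ>\<^sub>m \<tau> \<subseteq>\<^sub>m \<kappa> \<and> dom \<kappa> \<inter> dom \<tau> = dom (\<sigma> \<circ>\<^sub>m \<tau>)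
     \<and> ran \<kappa> \<inter> ran \<sigma> = ran (\<sigma> \<circ>\<^sub>m \<tau>)"

lemma admissible_extends:
  assumes "admissible \<kappa> \<sigma> \<tau>" "\<tau> k = Some j" "\<sigma> j = Some i"
  shows "\<kappa> k = Some i"
proof -
  have "(\<sigma> \<circ>\<^sub>m \<tau>) k = Some i"
    using assms by (simp add: map_comp_Some_iff)
  then show ?thesis
    using assms(1) unfolding admissible_def map_le_def by (metis domI)
qed

lemma admissible_dom:
  assumes "admissible \<kappa> \<sigma> \<tau>" "\<kappa> k = Some i" "\<tau> k = Some j"
  shows "\<sigma> j = Some i"
proof -
  have "k \<in> dom (\<sigma> \<circ>\<^sub>m \<tau>)"
    using assms unfolding admissible_def by blast
  then obtain i' where "\<sigma> j = Some i'"
    using assms(3) by (auto simp: map_comp_Some_iff)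
  then show ?thesis
    using admissible_extends[OF assms(1,3)] assms(2) by simp
qed

lemma admissible_ran:
  assumes "admissible \<kappa> \<sigma> \<tau>" "\<kappa> k = Some i" "\<sigma> j = Some i"
    and \<kappa>: "\<kappa> \<in> PB \<alpha>" and \<sigma>: "\<sigma> \<in> PB \<alpha>"
  shows "\<tau> k = Some j"
proof -
  have "i \<in> ran \<kappa> \<inter> ran \<sigma>"
    using assms(2,3) by (auto simp: ran_def)
  then have "i \<in> ran (\<sigma> \<circ>\<^sub>m \<tau>)"
    using assms(1) unfolding admissible_def by simp
  then obtain k' j' where k': "\<tau> k' = Some j'" "\<sigma> j' = Some i"
    by (auto simp: ran_def map_comp_Some_iff)
  have "k' = k"
    using PB_injD[OF \<kappa> admissible_extends[OF assms(1) k'] assms(2)] .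
  moreover have "j' = j"
    using PB_injD[OF \<sigma> k'(2) assms(3)] .
  ultimately show ?thesis
    using k' by simp
qed

lemma admissibleI:
  assumes P: "\<And>k j i. \<tau> k = Some j \<Longrightarrow> \<sigma> j = Some i \<Longrightarrow> \<kappa> k = Some i"
    and Q: "\<And>k j i. \<kappa> k = Some i \<Longrightarrow> \<tau> k = Some j \<Longrightarrow> \<sigma> j = Some i"
    and R: "\<And>k j i. \<kappa> k = Some i \<Longrightarrow> \<sigma> j = Some i \<Longrightarrow> \<tau> k = Some j"
  shows "admissible \<kappa> \<sigma> \<tau>"
proof -
  have comp: "\<kappa> k = Some i" if "(\<sigma> \<circ>\<^sub>m \<tau>) k = Some i" for k i
    using that P by (auto simp: map_comp_Some_iff)
  have "\<sigma> \<circ>\<^sub>m \<tau> \<subseteq>\<^sub>m \<kappa>"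
    unfolding map_le_def using comp by auto
  moreover have "dom \<kappa> \<inter> dom \<tau> = dom (\<sigma> \<circ>\<^sub>m \<tau>)"
  proof (intro equalityI subsetI)
    fix k assume "k \<in> dom \<kappa> \<inter> dom \<tau>"
    then obtain i j where "\<kappa> k = Some i" "\<tau> k = Some j" by auto
    with Q show "k \<in> dom (\<sigma> \<circ>\<^sub>m \<tau>)" by (auto simp: dom_def)
  next
    fix k assume "k \<in> dom (\<sigma> \<circ>\<^sub>m \<tau>)"
    then obtain i where "(\<sigma> \<circ>\<^sub>m \<tau>) k = Some i" by auto
    with comp[OF this] show "k \<in> dom \<kappa> \<inter> dom \<tau>"
      by (auto simp: map_comp_Some_iff)
  qed
  moreover have "ran \<kappa> \<inter> ran \<sigma> = ran (\<sigma> \<circ>\<^sub>m \<tau>)"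
  proof (intro equalityI subsetI)
    fix i assume "i \<in> ran \<kappa> \<inter> ran \<sigma>"
    then obtain k j where kj: "\<kappa> k = Some i" "\<sigma> j = Some i" by (auto simp: ran_def)
    with R[OF this] have "(\<sigma> \<circ>\<^sub>m \<tau>) k = Some i" by simp
    then show "i \<in> ran (\<sigma> \<circ>\<^sub>m \<tau>)" by (rule ranI)
  next
    fix i assume "i \<in> ran (\<sigma> \<circ>\<^sub>m \<tau>)"
    then obtain k where "(\<sigma> \<circ>\<^sub>m \<tau>) k = Some i" by (auto simp: ran_def)
    with comp[OF this] show "i \<in> ran \<kappa> \<inter> ran \<sigma>"
      by (auto simp: map_comp_Some_iff ran_def)
  qed
  ultimately show ?thesis
    by (simp add: admissible_def)
qed

lemma struct_const_admissible:
  "struct_const \<alpha> \<nu> \<kappa> \<sigma> \<tau> =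
     (if admissible \<kappa> \<sigma> \<tau>
      then \<Prod>m < \<alpha> + rk (\<sigma> \<circ>\<^sub>m \<tau>) - rk \<sigma> - rk \<tau>. \<nu> - of_nat \<alpha> + of_nat (rk \<kappa>) - of_nat m
      else 0)"
  by (simp add: struct_const_def admissible_def)

lemma admissible_coinc:
  assumes "inj_on x (Om \<alpha>)" "inj_on y (Om \<alpha>)" "inj_on z (Om \<alpha>)"
  shows "admissible (coinc \<alpha> x z) (coinc \<alpha> x y) (coinc \<alpha> y z)"
  using assms by (intro admissibleI) (auto simp: coinc_iff)

text \<open>
  The maps \<open>y\<close> in relative position \<open>\<sigma>\<close> to \<open>x\<close> and \<open>\<tau>\<close> to \<open>z\<close>: their values on \<open>dom \<sigma> \<union> ran \<tau>\<close> are
  forced, and all other values avoid those of \<open>x\<close> and \<open>z\<close>, since any coincidence would be recorded by \<open>\<sigma>\<close> or \<open>\<tau>\<close>.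
  Admissibility ensures that the forced values are consistent and involve no coincidences beyond the recorded ones.
\<close>

lemma intermediate_iff:
  assumes x: "inj_on x (Om \<alpha>)" and z: "inj_on z (Om \<alpha>)"
    and \<sigma>: "\<sigma> \<in> PB \<alpha>" and \<tau>: "\<tau> \<in> PB \<alpha>" and adm: "admissible (coinc \<alpha> x z) \<sigma> \<tau>"
  shows "inj_on y (Om \<alpha>) \<and> coinc \<alpha> x y = \<sigma> \<and> coinc \<alpha> y z = \<tau> \<longleftrightarrow>
    (\<forall>j i. \<sigma> j = Some i \<longrightarrow> y j = x i) \<and> (\<forall>k j. \<tau> k = Some j \<longrightarrow> y j = z k) \<and>
    inj_on y (Om \<alpha> - (dom \<sigma> \<union> ran \<tau>)) \<and>
    y ` (Om \<alpha> - (dom \<sigma> \<union> ran \<tau>)) \<inter> (x ` Om \<alpha> \<union> z ` Om \<alpha>) = {}"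
    (is "?L \<longleftrightarrow> ?R")
proof
  assume ?L
  then have y: "inj_on y (Om \<alpha>)"
    and \<sigma>y: "\<And>j i. \<sigma> j = Some i \<longleftrightarrow> i \<in> Om \<alpha> \<and> j \<in> Om \<alpha> \<and> x i = y j"
    and \<tau>y: "\<And>j i. \<tau> j = Some i \<longleftrightarrow> i \<in> Om \<alpha> \<and> j \<in> Om \<alpha> \<and> y i = z j"
    using x coinc_iff by auto
  then show ?R
    by (auto simp: \<sigma>y \<tau>y dom_def ran_def intro: inj_on_subset)
next
  assume R: ?R
  let ?\<kappa> = "coinc \<alpha> x z" and ?E = "Om \<alpha> - (dom \<sigma> \<union> ran \<tau>)"
  have \<kappa>: "?\<kappa> k = Some i \<longleftrightarrow> i \<in> Om \<alpha> \<and> k \<in> Om \<alpha> \<and> x i = z k" for k i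
    by (rule coinc_iff[OF x])
  note adm' = admissible_extends[OF adm] admissible_dom[OF adm]
    admissible_ran[OF adm _ _ coinc_PB[OF x z] \<sigma>]
  have y\<sigma>: "y j = x i" if "\<sigma> j = Some i" for j i
    using R that by blast
  have y\<tau>: "y j = z k" if "\<tau> k = Some j" for j k
    using R that by blast
  have out: "j \<notin> ?E" if "j \<in> Om \<alpha>" "i \<in> Om \<alpha>" "y j = x i \<or> y j = z i" for i j
    using R that by blast
  have xy: "\<sigma> j = Some i" if "i \<in> Om \<alpha>" "j \<in> Om \<alpha>" "x i = y j" for i j
  proof (cases "j \<in> dom \<sigma>")
    case True
    then obtain i' where "\<sigma> j = Some i'" by blast
    then show ?thesis
      using y\<sigma> that x PB_OmD[OF \<sigma>] by (metis inj_onD)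
  next
    case False
    moreover have "j \<notin> ?E"
      using out[of j i] that by simp
    ultimately obtain k where k: "\<tau> k = Some j"
      using \<open>j \<in> Om \<alpha>\<close> by (auto simp: ran_def)
    then have "?\<kappa> k = Some i"
      using that y\<tau>[OF k] PB_OmD[OF \<tau> k] by (simp add: \<kappa>)
    then show ?thesis
      using adm'(2) k by blast
  qed
  have yz: "\<tau> k = Some j" if "k \<in> Om \<alpha>" "j \<in> Om \<alpha>" "y j = z k" for k j
  proof (cases "j \<in> ran \<tau>")
    case True
    then obtain k' where "\<tau> k' = Some j" by (auto simp: ran_def)
    then show ?thesis
      using y\<tau> that z PB_OmD[OF \<tau>] by (metis inj_onD)
  next
    case False
    moreover have "j \<notin> ?E"
      using out[of j k] that by simp
    ultimately obtain i where i: "\<sigma> j = Some i"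
      using \<open>j \<in> Om \<alpha>\<close> by (auto simp: dom_def)
    then have "?\<kappa> k = Some i"
      using that y\<sigma>[OF i] PB_OmD[OF \<sigma> i] by (simp add: \<kappa>)
    then show ?thesis
      using adm'(3) i by blast
  qed
  have y: "inj_on y (Om \<alpha>)"
  proof (rule inj_onI)
    fix j j' assume *: "j \<in> Om \<alpha>" "j' \<in> Om \<alpha>" "y j = y j'"
    consider i where "\<sigma> j = Some i" | k where "\<tau> k = Some j" | "j \<in> ?E"
      using * by (cases "\<sigma> j"; cases "\<exists>k. \<tau> k = Some j") (auto simp: dom_def ran_def)
    then show "j = j'"
    proof cases
      case 1
      then have "\<sigma> j' = Some i"
        using xy[of i j'] y\<sigma>[of j i] * PB_OmD[OF \<sigma> 1] by simp
      with 1 show ?thesis using PB_injD[OF \<sigma>] by blast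
    next
      case 2
      then have "\<tau> k = Some j'"
        using yz[of k j'] y\<tau>[of k j] * PB_OmD[OF \<tau> 2] by simp
      with 2 show ?thesis by simp
    next
      case 3
      then have "y j \<notin> x ` Om \<alpha> \<union> z ` Om \<alpha>"
        using R by blast
      then have "j' \<in> ?E"
        using * y\<sigma> y\<tau> PB_OmD[OF \<sigma>] PB_OmD[OF \<tau>] by (auto simp: dom_def ran_def)
      with 3 * R show ?thesis
        by (meson inj_onD)
    qed
  qed
  moreover have "coinc \<alpha> x y = \<sigma>"
    unfolding map_eq_iff_Some coinc_iff[OF x] using xy y\<sigma> PB_OmD[OF \<sigma>] by metis
  moreover have "coinc \<alpha> y z = \<tau>"
    unfolding map_eq_iff_Some coinc_iff[OF y] using yz y\<tau> PB_OmD[OF \<tau>] by metis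
  ultimately show ?L
    by blast
qed

lemma rk_coinc:
  assumes "inj_on x (Om \<alpha>)" "inj_on z (Om \<alpha>)"
  shows "rk (coinc \<alpha> x z) = card (x ` Om \<alpha> \<inter> z ` Om \<alpha>)"
proof -
  have "dom (coinc \<alpha> x z) = {j \<in> Om \<alpha>. z j \<in> x ` Om \<alpha>}"
    by (auto simp: coinc_def dom_def)
  moreover have "z ` {j \<in> Om \<alpha>. z j \<in> B} = B \<inter> z ` Om \<alpha>" for B
    by auto
  ultimately have "z ` dom (coinc \<alpha> x z) = x ` Om \<alpha> \<inter> z ` Om \<alpha>"
    by simp
  moreover have "inj_on z (dom (coinc \<alpha> x z))"
    using assms by (auto simp: coinc_def inj_on_def dom_def split: if_splits)
  ultimately show ?thesis
    unfolding rk_def by (metis card_image)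
qed

text \<open>
  The truncated differences do no harm: if one of them is truncated, an earlier factor is zero on both sides.
\<close>

lemma prod_of_nat_diff:
  "of_nat (\<Prod>m<l. N - m) = (\<Prod>m<l. of_nat N - of_nat m :: 'a :: {comm_ring_1, semiring_char_0})"
proof (cases "l \<le> N")
  case True
  then show ?thesis
    by (simp add: of_nat_diff)
next
  case False
  then have "(\<Prod>m<l. N - m) = 0" "(\<Prod>m<l. of_nat N - of_nat m :: 'a) = 0"
    by (auto intro!: prod_zero bexI[of _ N])
  then show ?thesis
    by (simp only: of_nat_0)
qed

text \<open>
  The combinatorial meaning of the structure constants. The free part of \<open>y\<close> is an injection of the
  \<open>l\<close> indices outside \<open>dom \<sigma> \<union> ran \<tau>\<close> into the \<open>n - 2\<alpha> + rk \<kappa>\<close> points that are values of neither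
  \<open>x\<close> nor \<open>z\<close>, where \<open>\<kappa>\<close> is the relative position of \<open>x\<close> and \<open>z\<close>. With \<open>\<nu> = n - \<alpha>\<close> this is the
  falling factorial with \<open>l\<close> factors that starts at \<open>\<nu> - \<alpha> + rk \<kappa>\<close>.
\<close>

lemma card_intermediate:
  assumes x: "x \<in> inj_maps \<alpha> n" and z: "z \<in> inj_maps \<alpha> n"
    and \<sigma>: "\<sigma> \<in> PB \<alpha>" and \<tau>: "\<tau> \<in> PB \<alpha>"
  shows "of_nat (card {y \<in> inj_maps \<alpha> n. coinc \<alpha> x y = \<sigma> \<and> coinc \<alpha> y z = \<tau>}) =
    struct_const \<alpha> (of_nat n - of_nat \<alpha>) (coinc \<alpha> x z) \<sigma> \<tau>"
proof (cases "admissible (coinc \<alpha> x z) \<sigma> \<tau>")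
  case False
  then have "{y \<in> inj_maps \<alpha> n. coinc \<alpha> x y = \<sigma> \<and> coinc \<alpha> y z = \<tau>} = {}"
    using x z admissible_coinc by (auto simp: inj_maps_def)
  then show ?thesis
    using False by (simp add: struct_const_admissible)
next
  case adm: True
  have xi: "inj_on x (Om \<alpha>)" and zi: "inj_on z (Om \<alpha>)"
    and xn: "x ` Om \<alpha> \<subseteq> {1..n}" and zn: "z ` Om \<alpha> \<subseteq> {1..n}"
    using x z by (auto simp: inj_maps_def)
  let ?D = "dom \<sigma> \<union> ran \<tau>"
  let ?E = "Om \<alpha> - ?D" and ?O = "{1..n} - (x ` Om \<alpha> \<union> z ` Om \<alpha>)"
  let ?S = "{y \<in> inj_maps \<alpha> n. coinc \<alpha> x y = \<sigma> \<and> coinc \<alpha> y z = \<tau>}"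
  let ?F = "{f \<in> ?E \<rightarrow>\<^sub>E ?O. inj_on f ?E}"
  have S: "y \<in> ?S \<longleftrightarrow> y \<in> Om \<alpha> \<rightarrow>\<^sub>E {1..n} \<and> (\<forall>j i. \<sigma> j = Some i \<longrightarrow> y j = x i) \<and>
      (\<forall>k j. \<tau> k = Some j \<longrightarrow> y j = z k) \<and> inj_on y ?E \<and> y ` ?E \<inter> (x ` Om \<alpha> \<union> z ` Om \<alpha>) = {}" for y
    using intermediate_iff[OF xi zi \<sigma> \<tau> adm, of y] by (simp add: inj_maps_def conj_assoc)
  \<comment> \<open>The forced values of y; the two prescriptions agree on the overlap by admissibility.\<close>
  define y0 where "y0 j = (if j \<in> dom \<sigma> then x (the (\<sigma> j)) else z (THE k. \<tau> k = Some j))" for j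
  have y0\<sigma>: "y0 j = x i" if "\<sigma> j = Some i" for j i
    using that by (auto simp: y0_def)
  have y0\<tau>: "y0 j = z k" if "\<tau> k = Some j" for k j
  proof (cases "\<sigma> j")
    case None
    moreover have "(THE k. \<tau> k = Some j) = k"
      using that PB_injD[OF \<tau>] by blast
    ultimately show ?thesis
      by (auto simp: y0_def)
  next
    case (Some i)
    then have "coinc \<alpha> x z k = Some i"
      using admissible_extends[OF adm that] by simp
    then show ?thesis
      using Some by (simp add: y0\<sigma> coinc_iff[OF xi])
  qed
  have D: "?D \<subseteq> Om \<alpha>"
    using \<sigma> \<tau> by (auto simp: PB_def)
  have "bij_betw (\<lambda>y. restrict y ?E) ?S ?F"
  proof (rule bij_betwI[where g = "\<lambda>f j. if j \<in> ?D then y0 j else f j"])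
    show "(\<lambda>y. restrict y ?E) \<in> ?S \<rightarrow> ?F"
    proof
      fix y assume "y \<in> ?S"
      then have "y \<in> Om \<alpha> \<rightarrow>\<^sub>E {1..n}" "inj_on y ?E" "y ` ?E \<inter> (x ` Om \<alpha> \<union> z ` Om \<alpha>) = {}"
        by (simp_all only: S simp_thms)
      then show "restrict y ?E \<in> ?F"
        by (auto simp: inj_on_def PiE_iff)
    qed
    show "(\<lambda>f j. if j \<in> ?D then y0 j else f j) \<in> ?F \<rightarrow> ?S"
    proof
      fix f assume f: "f \<in> ?F"
      let ?y = "\<lambda>j. if j \<in> ?D then y0 j else f j"
      have "?y j \<in> {1..n}" if "j \<in> Om \<alpha>" for j
      proof -
        consider i where "\<sigma> j = Some i" | k where "\<tau> k = Some j" | "j \<notin> ?D"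
          by (cases "\<sigma> j"; cases "\<exists>k. \<tau> k = Some j") (auto simp: dom_def ran_def)
        then show ?thesis
        proof cases
          case 1
          moreover from this have "j \<in> ?D" by blast
          ultimately show ?thesis using y0\<sigma>[OF 1] PB_OmD[OF \<sigma> 1] xn by auto
        next
          case 2
          moreover from this have "j \<in> ?D" by (auto simp: ran_def)
          ultimately show ?thesis using y0\<tau>[OF 2] PB_OmD[OF \<tau> 2] zn by auto
        next
          case 3
          then show ?thesis using f that by auto
        qed
      qed
      moreover have "?y j = undefined" if "j \<notin> Om \<alpha>" for j
        using f D that by (auto simp: PiE_iff extensional_def)
      moreover have "?y j = x i" if "\<sigma> j = Some i" for j i
        using that y0\<sigma> by auto
      moreover have "?y j = z k" if "\<tau> k = Some j" for j k
        using that y0\<tau> by (auto simp: ran_def)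
      moreover have "inj_on ?y ?E" "?y ` ?E \<inter> (x ` Om \<alpha> \<union> z ` Om \<alpha>) = {}"
        using f by (auto simp: inj_on_def PiE_iff)
      ultimately show "?y \<in> ?S"
        unfolding S by (auto intro!: PiE_I simp del: Un_iff)
    qed
    show "(\<lambda>j. if j \<in> ?D then y0 j else restrict y ?E j) = y" if "y \<in> ?S" for y
    proof
      fix j
      have y: "y \<in> Om \<alpha> \<rightarrow>\<^sub>E {1..n}" "\<And>j i. \<sigma> j = Some i \<Longrightarrow> y j = x i" "\<And>k j. \<tau> k = Some j \<Longrightarrow> y j = z k"
        using that by (simp_all only: S simp_thms)
      consider i where "\<sigma> j = Some i" | k where "\<tau> k = Some j" | "j \<notin> ?D" "j \<in> Om \<alpha>" | "j \<notin> Om \<alpha>"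
        by (cases "\<sigma> j"; cases "\<exists>k. \<tau> k = Some j") (auto simp: dom_def ran_def)
      then show "(if j \<in> ?D then y0 j else restrict y ?E j) = y j"
      proof cases
        case 1
        then show ?thesis using y(2) y0\<sigma> by auto
      next
        case 2
        then show ?thesis using y(3) y0\<tau> by (auto simp: ran_def)
      next
        case 3
        then show ?thesis by auto
      next
        case 4
        then show ?thesis using y(1) D by (auto simp: PiE_iff extensional_def)
      qed
    qed
    show "restrict (\<lambda>j. if j \<in> ?D then y0 j else f j) ?E = f" if "f \<in> ?F" for f
      using that by (auto simp: PiE_iff extensional_def restrict_def fun_eq_iff)
  qed
  then have "card ?S = card ?F"
    by (rule bij_betw_same_card)
  also have "\<dots> = (\<Prod>m<card ?E. card ?O - m)"
    using card_inj_on_subset_funcset[of ?E ?O ?E] by (simp add: lessThan_atLeast0)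
  finally have "card ?S = (\<Prod>m<card ?E. card ?O - m)" .
  moreover have "card ?E = \<alpha> + rk (\<sigma> \<circ>\<^sub>m \<tau>) - rk \<sigma> - rk \<tau>"
    using card_dom_Un_ran[OF \<sigma> \<tau>] D card_Diff_subset[of ?D "Om \<alpha>"]
      finite_dom_PB[OF \<sigma>] finite_ran_PB[OF \<tau>] by simp
  moreover have "(of_nat (card ?O) :: complex) = of_nat n - of_nat \<alpha> - of_nat \<alpha> + of_nat (rk (coinc \<alpha> x z))"
  proof -
    have U: "x ` Om \<alpha> \<union> z ` Om \<alpha> \<subseteq> {1..n}"
      using xn zn by blast
    then have "card (x ` Om \<alpha> \<union> z ` Om \<alpha>) \<le> n"
      using card_mono[OF _ U] by simp
    moreover have "card ?O = n - card (x ` Om \<alpha> \<union> z ` Om \<alpha>)"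
      using U by (subst card_Diff_subset) (auto intro: finite_subset)
    moreover have "\<alpha> + \<alpha> = card (x ` Om \<alpha> \<union> z ` Om \<alpha>) + rk (coinc \<alpha> x z)"
      using card_Un_Int[of "x ` Om \<alpha>" "z ` Om \<alpha>"] rk_coinc[OF xi zi] xi zi by (simp add: card_image)
    ultimately have "card ?O + \<alpha> + \<alpha> = n + rk (coinc \<alpha> x z)"
      by linarith
    then have "(of_nat (card ?O + \<alpha> + \<alpha>) :: complex) = of_nat (n + rk (coinc \<alpha> x z))"
      by (simp only:)
    then show ?thesis
      by (simp add: algebra_simps)
  qed
  ultimately show ?thesis
    using adm by (simp only: prod_of_nat_diff struct_const_admissible if_True)
qed

text \<open>
  The map \<open>w\<close> takes the value prescribed by \<open>\<mu>\<close> where there is one, and otherwise a new value beyond those of \<open>x\<close>;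
  this needs up to \<open>2\<alpha>\<close> points.
\<close>

lemma coinc_surj:
  assumes \<mu>: "\<mu> \<in> PB \<alpha>" and n: "2 * \<alpha> \<le> n"
  obtains x w where "x \<in> inj_maps \<alpha> n" "w \<in> inj_maps \<alpha> n" "coinc \<alpha> x w = \<mu>"
proof -
  define x where "x = restrict (\<lambda>i. i) (Om \<alpha>)"
  define w where "w = restrict (\<lambda>k. case \<mu> k of Some i \<Rightarrow> i | None \<Rightarrow> \<alpha> + k) (Om \<alpha>)"
  have w_cases: "w k = i \<longleftrightarrow> \<mu> k = Some i \<or> \<mu> k = None \<and> i = \<alpha> + k" if "k \<in> Om \<alpha>" for k i
    using that by (auto simp: w_def split: option.splits)
  have x: "x \<in> inj_maps \<alpha> n"
    using n by (auto simp: x_def inj_maps_def inj_on_def Om_def)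
  moreover have "w \<in> inj_maps \<alpha> n"
  proof -
    have "w \<in> Om \<alpha> \<rightarrow>\<^sub>E {1..n}"
      using n PB_OmD[OF \<mu>] by (fastforce simp: w_def Om_def split: option.splits)
    moreover have "inj_on w (Om \<alpha>)"
    proof (rule inj_onI)
      fix k k' assume k: "k \<in> Om \<alpha>" "k' \<in> Om \<alpha>" "w k = w k'"
      have "w k = w k" by simp
      then show "k = k'"
        using k w_cases[of k "w k"] w_cases[of k' "w k"] PB_OmD[OF \<mu>] PB_injD[OF \<mu>]
        by (fastforce simp: Om_def)
    qed
    ultimately show ?thesis
      by (simp add: inj_maps_def)
  qed
  moreover have "coinc \<alpha> x w = \<mu>"
  proof -
    have "coinc \<alpha> x w k = Some i \<longleftrightarrow> \<mu> k = Some i" for k i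
    proof -
      have "coinc \<alpha> x w k = Some i \<longleftrightarrow> i \<in> Om \<alpha> \<and> k \<in> Om \<alpha> \<and> w k = i"
        using x coinc_iff[of x \<alpha> w k i] by (auto simp: inj_maps_def x_def)
      then show ?thesis
        using w_cases[of k i] PB_OmD[OF \<mu>, of k i] by (auto simp: Om_def)
    qed
    then show ?thesis
      by (simp add: map_eq_iff_Some)
  qed
  ultimately show ?thesis
    using that by blast
qed

text \<open>
  For fixed \<open>x\<close> and \<open>w\<close> in relative position \<open>\<mu>\<close>, both sides count the pairs \<open>(y, z)\<close> such that the consecutive pairs
  in \<open>x\<close>, \<open>y\<close>, \<open>z\<close>, \<open>w\<close> have relative positions \<open>\<sigma>\<close>, \<open>\<tau>\<close>, \<open>\<rho>\<close>; on the left \<open>\<kappa>\<close> is the relative position of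
  \<open>x\<close> and \<open>z\<close>, on the right that of \<open>y\<close> and \<open>w\<close>.
\<close>

lemma struct_const_assoc_nat:
  assumes PB: "\<sigma> \<in> PB \<alpha>" "\<tau> \<in> PB \<alpha>" "\<rho> \<in> PB \<alpha>" "\<mu> \<in> PB \<alpha>" and n: "2 * \<alpha> \<le> n"
  defines "c \<equiv> struct_const \<alpha> (of_nat n - of_nat \<alpha>)"
  shows "(\<Sum>\<kappa>\<in>PB \<alpha>. c \<kappa> \<sigma> \<tau> * c \<mu> \<kappa> \<rho>) = (\<Sum>\<kappa>\<in>PB \<alpha>. c \<mu> \<sigma> \<kappa> * c \<kappa> \<tau> \<rho>)"
proof -
  let ?X = "inj_maps \<alpha> n"
  obtain x w where xw: "x \<in> ?X" "w \<in> ?X" "coinc \<alpha> x w = \<mu>"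
    using coinc_surj[OF PB(4) n] .
  have coinc_in: "coinc \<alpha> y z \<in> PB \<alpha>" if "y \<in> ?X" "z \<in> ?X" for y z
    using that by (auto simp: inj_maps_def intro: coinc_PB)
  have count: "(\<Sum>y\<in>?X. of_bool (coinc \<alpha> u y = \<sigma>') * of_bool (coinc \<alpha> y v = \<tau>')) = c (coinc \<alpha> u v) \<sigma>' \<tau>'"
    if "u \<in> ?X" "v \<in> ?X" "\<sigma>' \<in> PB \<alpha>" "\<tau>' \<in> PB \<alpha>" for u v \<sigma>' \<tau>'
    unfolding c_def card_intermediate[OF that, symmetric]
    by (simp flip: of_bool_conj add: Int_def conj_commute)
  have expand: "f (coinc \<alpha> u v) = (\<Sum>\<kappa>\<in>PB \<alpha>. f \<kappa> * of_bool (coinc \<alpha> u v = \<kappa>))"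
    if "u \<in> ?X" "v \<in> ?X" for u v and f :: "pbij \<Rightarrow> complex"
    using coinc_in[OF that] by (simp add: of_bool_def if_distrib cong: if_cong)
  have "(\<Sum>\<kappa>\<in>PB \<alpha>. c \<kappa> \<sigma> \<tau> * c \<mu> \<kappa> \<rho>) =
      (\<Sum>\<kappa>\<in>PB \<alpha>. c \<kappa> \<sigma> \<tau> * (\<Sum>z\<in>?X. of_bool (coinc \<alpha> x z = \<kappa>) * of_bool (coinc \<alpha> z w = \<rho>)))"
    using count[OF xw(1,2) _ PB(3)] by (simp add: xw(3))
  also have "\<dots> = (\<Sum>z\<in>?X. (\<Sum>\<kappa>\<in>PB \<alpha>. c \<kappa> \<sigma> \<tau> * of_bool (coinc \<alpha> x z = \<kappa>)) * of_bool (coinc \<alpha> z w = \<rho>))"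
    unfolding sum_distrib_left sum_distrib_right by (subst sum.swap) (simp add: mult.assoc)
  also have "\<dots> = (\<Sum>z\<in>?X. c (coinc \<alpha> x z) \<sigma> \<tau> * of_bool (coinc \<alpha> z w = \<rho>))"
    by (intro sum.cong refl) (simp only: expand[OF xw(1), symmetric, of _ "\<lambda>\<kappa>. c \<kappa> \<sigma> \<tau>"])
  also have "\<dots> = (\<Sum>z\<in>?X. (\<Sum>y\<in>?X. of_bool (coinc \<alpha> x y = \<sigma>) * of_bool (coinc \<alpha> y z = \<tau>)) * of_bool (coinc \<alpha> z w = \<rho>))"
    by (intro sum.cong refl) (simp only: count[OF xw(1) _ PB(1,2)])
  also have "\<dots> = (\<Sum>y\<in>?X. of_bool (coinc \<alpha> x y = \<sigma>) * (\<Sum>z\<in>?X. of_bool (coinc \<alpha> y z = \<tau>) * of_bool (coinc \<alpha> z w = \<rho>)))"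
    unfolding sum_distrib_left sum_distrib_right by (subst sum.swap) (simp only: mult.assoc)
  also have "\<dots> = (\<Sum>y\<in>?X. of_bool (coinc \<alpha> x y = \<sigma>) * c (coinc \<alpha> y w) \<tau> \<rho>)"
    by (intro sum.cong refl) (simp only: count[OF _ xw(2) PB(2,3)])
  also have "\<dots> = (\<Sum>y\<in>?X. of_bool (coinc \<alpha> x y = \<sigma>) * (\<Sum>\<kappa>\<in>PB \<alpha>. c \<kappa> \<tau> \<rho> * of_bool (coinc \<alpha> y w = \<kappa>)))"
    by (intro sum.cong refl) (simp only: expand[OF _ xw(2), symmetric, of _ "\<lambda>\<kappa>. c \<kappa> \<tau> \<rho>"])
  also have "\<dots> = (\<Sum>\<kappa>\<in>PB \<alpha>. (\<Sum>y\<in>?X. of_bool (coinc \<alpha> x y = \<sigma>) * of_bool (coinc \<alpha> y w = \<kappa>)) * c \<kappa> \<tau> \<rho>)"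
    unfolding sum_distrib_left sum_distrib_right by (subst sum.swap) (simp only: mult_ac)
  also have "\<dots> = (\<Sum>\<kappa>\<in>PB \<alpha>. c \<mu> \<sigma> \<kappa> * c \<kappa> \<tau> \<rho>)"
    using count[OF xw(1,2) PB(1)] by (simp add: xw(3))
  finally show ?thesis .
qed

definition struct_poly :: "nat \<Rightarrow> pbij \<Rightarrow> pbij \<Rightarrow> pbij \<Rightarrow> complex poly" where
  "struct_poly \<alpha> \<kappa> \<sigma> \<tau> =
     (if admissible \<kappa> \<sigma> \<tau>
      then \<Prod>m < \<alpha> + rk (\<sigma> \<circ>\<^sub>m \<tau>) - rk \<sigma> - rk \<tau>. [:of_nat (rk \<kappa>) - of_nat \<alpha> - of_nat m, 1:]
      else 0)"

lemma poly_struct_poly: "poly (struct_poly \<alpha> \<kappa> \<sigma> \<tau>) \<nu> = struct_const \<alpha> \<nu> \<kappa> \<sigma> \<tau>"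
  by (simp add: struct_poly_def struct_const_admissible poly_prod algebra_simps)

lemma struct_const_assoc:
  assumes "\<sigma> \<in> PB \<alpha>" "\<tau> \<in> PB \<alpha>" "\<rho> \<in> PB \<alpha>" "\<mu> \<in> PB \<alpha>"
  shows "(\<Sum>\<kappa>\<in>PB \<alpha>. struct_const \<alpha> \<nu> \<kappa> \<sigma> \<tau> * struct_const \<alpha> \<nu> \<mu> \<kappa> \<rho>) =
    (\<Sum>\<kappa>\<in>PB \<alpha>. struct_const \<alpha> \<nu> \<mu> \<sigma> \<kappa> * struct_const \<alpha> \<nu> \<kappa> \<tau> \<rho>)"
proof -
  define P where "P = (\<Sum>\<kappa>\<in>PB \<alpha>. struct_poly \<alpha> \<kappa> \<sigma> \<tau> * struct_poly \<alpha> \<mu> \<kappa> \<rho>) -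
    (\<Sum>\<kappa>\<in>PB \<alpha>. struct_poly \<alpha> \<mu> \<sigma> \<kappa> * struct_poly \<alpha> \<kappa> \<tau> \<rho>)"
  have P: "poly P \<nu> = (\<Sum>\<kappa>\<in>PB \<alpha>. struct_const \<alpha> \<nu> \<kappa> \<sigma> \<tau> * struct_const \<alpha> \<nu> \<mu> \<kappa> \<rho>) -
    (\<Sum>\<kappa>\<in>PB \<alpha>. struct_const \<alpha> \<nu> \<mu> \<sigma> \<kappa> * struct_const \<alpha> \<nu> \<kappa> \<tau> \<rho>)" for \<nu>
    by (simp add: P_def poly_sum poly_struct_poly)
  have "(\<lambda>n. of_nat n - of_nat \<alpha>) ` {2 * \<alpha>..} \<subseteq> {\<nu>. poly P \<nu> = 0}"
    using struct_const_assoc_nat[OF assms] by (auto simp: P)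
  moreover have "infinite ((\<lambda>n. of_nat n - of_nat \<alpha> :: complex) ` {2 * \<alpha>..})"
    by (subst finite_image_iff) (auto simp: inj_on_def infinite_Ici)
  ultimately have "P = 0"
    using poly_roots_finite finite_subset by blast
  then show ?thesis
    using P[of \<nu>] by simp
qed

section \<open>Scalar multiplication of finitely supported functions\<close>

lemma lookup_scal [simp]: "Poly_Mapping.lookup (scal c p) k = c * Poly_Mapping.lookup p k"
  by (simp add: scal_def Poly_Mapping.map.rep_eq when_def)

lemma scal_add: "scal c (p + q) = scal c p + scal c q"
  and scal_add_left: "scal (c + d) p = scal c p + scal d p"
  and scal_diff: "scal c (p - q) = scal c p - scal c q"
  and scal_scal: "scal c (scal d p) = scal (c * d) p"
  and scal_one [simp]: "scal 1 p = p"
  and scal_zero_left [simp]: "scal 0 p = 0"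
  and scal_zero [simp]: "scal c 0 = 0"
  and scal_minus_one: "scal (- 1) p = - p"
  by (auto intro!: poly_mapping_eqI simp: lookup_add lookup_minus algebra_simps)

lemma scal_sum: "scal c (\<Sum>i\<in>A. f i) = (\<Sum>i\<in>A. scal c (f i))"
  by (induction A rule: infinite_finite_induct) (auto simp: scal_add)

lemma scal_sum_left: "scal (\<Sum>i\<in>A. f i) p = (\<Sum>i\<in>A. scal (f i) p)"
  by (induction A rule: infinite_finite_induct) (auto simp: scal_add_left)

lemma scal_single: "scal c (Poly_Mapping.single k d) = Poly_Mapping.single k (c * d)"
  by (simp add: scal_def)

lemma keys_scal: "Poly_Mapping.keys (scal c p) \<subseteq> Poly_Mapping.keys p"
  by (auto simp: in_keys_iff)

lemma mult_scal_left: "scal c p * q = scal c (p * (q :: 'a::monoid_add \<Rightarrow>\<^sub>0 complex))"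
  by (simp add: scal_def mult_map_scale_conv_mult mult.assoc)

lemma sum_single_keys:
  assumes "finite K" "Poly_Mapping.keys p \<subseteq> K"
  shows "p = (\<Sum>k\<in>K. Poly_Mapping.single k (Poly_Mapping.lookup p k))"
proof (rule poly_mapping_eqI)
  fix k
  have "(\<Sum>j\<in>K. Poly_Mapping.lookup (Poly_Mapping.single j (Poly_Mapping.lookup p j)) k)
      = (\<Sum>j\<in>K. if j = k then Poly_Mapping.lookup p k else 0)"
    by (intro sum.cong refl) (auto simp: lookup_single when_def)
  also have "\<dots> = Poly_Mapping.lookup p k"
    using assms by (auto simp: in_keys_iff)
  finally show "Poly_Mapping.lookup p k = Poly_Mapping.lookup (\<Sum>k\<in>K. Poly_Mapping.single k (Poly_Mapping.lookup p k)) k"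
    by (simp add: lookup_sum)
qed

lemma mult_scal_right: "p * scal c q = scal c (p * (q :: 'a::monoid_add \<Rightarrow>\<^sub>0 complex))"
proof -
  have commute: "Poly_Mapping.single u a * Poly_Mapping.single 0 c = Poly_Mapping.single 0 c * Poly_Mapping.single u a"
    for u :: 'a and a
    by (simp add: mult_single mult.commute)
  have "p * Poly_Mapping.single 0 c = Poly_Mapping.single 0 c * p"
    by (subst (1 2) sum_single_keys[of "Poly_Mapping.keys p" p])
      (simp_all only: finite_keys order_refl sum_distrib_left sum_distrib_right commute)
  then show ?thesis
    unfolding scal_def mult_map_scale_conv_mult by (metis mult.assoc)
qed

section \<open>The ring structure on the algebra with basis PB\<close>

definition O_carrier :: "nat \<Rightarrow> (pbij \<Rightarrow>\<^sub>0 complex) set" where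
  "O_carrier \<alpha> = {p. Poly_Mapping.keys p \<subseteq> PB \<alpha>}"

lemma O_carrier_iff: "p \<in> O_carrier \<alpha> \<longleftrightarrow> (\<forall>\<kappa>. \<kappa> \<notin> PB \<alpha> \<longrightarrow> Poly_Mapping.lookup p \<kappa> = 0)"
  by (auto simp: O_carrier_def in_keys_iff)

lemma O_carrier_Xi [intro]: "\<sigma> \<in> PB \<alpha> \<Longrightarrow> Xi \<sigma> \<in> O_carrier \<alpha>"
  by (simp add: O_carrier_def Xi_def)

lemma O_carrier_0 [intro]: "0 \<in> O_carrier \<alpha>"
  and O_carrier_add [intro]: "p \<in> O_carrier \<alpha> \<Longrightarrow> q \<in> O_carrier \<alpha> \<Longrightarrow> p + q \<in> O_carrier \<alpha>"
  and O_carrier_diff [intro]: "p \<in> O_carrier \<alpha> \<Longrightarrow> q \<in> O_carrier \<alpha> \<Longrightarrow> p - q \<in> O_carrier \<alpha>"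
  and O_carrier_scal [intro]: "p \<in> O_carrier \<alpha> \<Longrightarrow> scal c p \<in> O_carrier \<alpha>"
  by (simp_all add: O_carrier_iff lookup_add lookup_minus)

lemma O_carrier_sum [intro]:
  "(\<And>i. i \<in> A \<Longrightarrow> f i \<in> O_carrier \<alpha>) \<Longrightarrow> (\<Sum>i\<in>A. f i) \<in> O_carrier \<alpha>"
  by (induction A rule: infinite_finite_induct) auto

lemma lookup_Xi: "Poly_Mapping.lookup (Xi \<sigma>) \<kappa> = of_bool (\<sigma> = \<kappa>)"
  by (simp add: Xi_def lookup_single when_def)

lemma lookup_sum_Xi:
  assumes "finite K"
  shows "Poly_Mapping.lookup (\<Sum>\<kappa>\<in>K. scal (f \<kappa>) (Xi \<kappa>)) \<mu> = (if \<mu> \<in> K then f \<mu> else 0)"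
  using assms by (simp add: lookup_sum lookup_Xi of_bool_def if_distrib cong: if_cong)

lemma lookup_O_mult:
  assumes "p \<in> O_carrier \<alpha>" "q \<in> O_carrier \<alpha>"
  shows "Poly_Mapping.lookup (O_mult \<alpha> \<nu> p q) \<kappa> =
    (if \<kappa> \<in> PB \<alpha> then \<Sum>\<sigma>\<in>PB \<alpha>. \<Sum>\<tau>\<in>PB \<alpha>.
       Poly_Mapping.lookup p \<sigma> * Poly_Mapping.lookup q \<tau> * struct_const \<alpha> \<nu> \<kappa> \<sigma> \<tau> else 0)"
proof -
  let ?f = "\<lambda>\<sigma> \<tau>. Poly_Mapping.lookup p \<sigma> * Poly_Mapping.lookup q \<tau> *
    (if \<kappa> \<in> PB \<alpha> then struct_const \<alpha> \<nu> \<kappa> \<sigma> \<tau> else 0)"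
  have "Poly_Mapping.lookup (O_mult \<alpha> \<nu> p q) \<kappa> =
      (\<Sum>\<sigma>\<in>Poly_Mapping.keys p. \<Sum>\<tau>\<in>Poly_Mapping.keys q. ?f \<sigma> \<tau>)"
    by (simp add: O_mult_def lookup_sum lookup_Xi of_bool_def if_distrib cong: if_cong)
  also have "\<dots> = (\<Sum>\<sigma>\<in>Poly_Mapping.keys p. \<Sum>\<tau>\<in>PB \<alpha>. ?f \<sigma> \<tau>)"
    using assms by (intro sum.cong refl sum.mono_neutral_left) (auto simp: O_carrier_def in_keys_iff)
  also have "\<dots> = (\<Sum>\<sigma>\<in>PB \<alpha>. \<Sum>\<tau>\<in>PB \<alpha>. ?f \<sigma> \<tau>)"
    using assms by (intro sum.mono_neutral_left) (auto simp: O_carrier_def in_keys_iff)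
  finally show ?thesis
    by simp
qed

lemma O_carrier_mult [intro]:
  "p \<in> O_carrier \<alpha> \<Longrightarrow> q \<in> O_carrier \<alpha> \<Longrightarrow> O_mult \<alpha> \<nu> p q \<in> O_carrier \<alpha>"
  by (simp add: O_carrier_iff[of "O_mult \<alpha> \<nu> p q"] lookup_O_mult)

lemma O_mult_add_left:
  assumes "p \<in> O_carrier \<alpha>" "p' \<in> O_carrier \<alpha>" "q \<in> O_carrier \<alpha>"
  shows "O_mult \<alpha> \<nu> (p + p') q = O_mult \<alpha> \<nu> p q + O_mult \<alpha> \<nu> p' q"
  using assms by (intro poly_mapping_eqI)
    (simp add: lookup_O_mult O_carrier_add lookup_add algebra_simps sum.distrib)

lemma O_mult_add_right:
  assumes "p \<in> O_carrier \<alpha>" "q \<in> O_carrier \<alpha>" "q' \<in> O_carrier \<alpha>"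
  shows "O_mult \<alpha> \<nu> p (q + q') = O_mult \<alpha> \<nu> p q + O_mult \<alpha> \<nu> p q'"
  using assms by (intro poly_mapping_eqI)
    (simp add: lookup_O_mult O_carrier_add lookup_add algebra_simps sum.distrib)

lemma O_mult_scal_left:
  assumes "p \<in> O_carrier \<alpha>" "q \<in> O_carrier \<alpha>"
  shows "O_mult \<alpha> \<nu> (scal c p) q = scal c (O_mult \<alpha> \<nu> p q)"
  using assms by (intro poly_mapping_eqI)
    (simp add: lookup_O_mult O_carrier_scal sum_distrib_left mult_ac)

lemma O_mult_scal_right:
  assumes "p \<in> O_carrier \<alpha>" "q \<in> O_carrier \<alpha>"
  shows "O_mult \<alpha> \<nu> p (scal c q) = scal c (O_mult \<alpha> \<nu> p q)"
  using assms by (intro poly_mapping_eqI)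
    (simp add: lookup_O_mult O_carrier_scal sum_distrib_left mult_ac)

lemma O_mult_zero [simp]: "O_mult \<alpha> \<nu> 0 q = 0" "O_mult \<alpha> \<nu> p 0 = 0"
  by (simp_all add: O_mult_def)

lemma O_mult_diff_left:
  assumes "p \<in> O_carrier \<alpha>" "p' \<in> O_carrier \<alpha>" "q \<in> O_carrier \<alpha>"
  shows "O_mult \<alpha> \<nu> (p - p') q = O_mult \<alpha> \<nu> p q - O_mult \<alpha> \<nu> p' q"
  using O_mult_add_left[of "p - p'" \<alpha> p' q \<nu>] assms by (simp add: O_carrier_diff)

lemma O_mult_diff_right:
  assumes "p \<in> O_carrier \<alpha>" "q \<in> O_carrier \<alpha>" "q' \<in> O_carrier \<alpha>"
  shows "O_mult \<alpha> \<nu> p (q - q') = O_mult \<alpha> \<nu> p q - O_mult \<alpha> \<nu> p q'"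
  using O_mult_add_right[of p \<alpha> "q - q'" q' \<nu>] assms by (simp add: O_carrier_diff)

lemma O_mult_sum_left:
  assumes "\<And>i. i \<in> A \<Longrightarrow> f i \<in> O_carrier \<alpha>" "q \<in> O_carrier \<alpha>"
  shows "O_mult \<alpha> \<nu> (\<Sum>i\<in>A. f i) q = (\<Sum>i\<in>A. O_mult \<alpha> \<nu> (f i) q)"
  using assms
  by (induction A rule: infinite_finite_induct) (simp_all add: O_mult_add_left O_carrier_sum)

lemma O_mult_sum_right:
  assumes "p \<in> O_carrier \<alpha>" "\<And>i. i \<in> A \<Longrightarrow> f i \<in> O_carrier \<alpha>"
  shows "O_mult \<alpha> \<nu> p (\<Sum>i\<in>A. f i) = (\<Sum>i\<in>A. O_mult \<alpha> \<nu> p (f i))"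
  using assms
  by (induction A rule: infinite_finite_induct) (simp_all add: O_mult_add_right O_carrier_sum)

lemma O_mult_Xi:
  assumes "\<sigma> \<in> PB \<alpha>" "\<tau> \<in> PB \<alpha>"
  shows "O_mult \<alpha> \<nu> (Xi \<sigma>) (Xi \<tau>) = (\<Sum>\<kappa>\<in>PB \<alpha>. scal (struct_const \<alpha> \<nu> \<kappa> \<sigma> \<tau>) (Xi \<kappa>))"
  by (simp add: O_mult_def Xi_def)

lemma O_carrier_expand: "p \<in> O_carrier \<alpha> \<Longrightarrow> p = (\<Sum>\<sigma>\<in>PB \<alpha>. scal (Poly_Mapping.lookup p \<sigma>) (Xi \<sigma>))"
  using sum_single_keys[of "PB \<alpha>" p] by (simp add: O_carrier_def Xi_def scal_single)

text \<open>
  Bilinear identities in \<^const>\<open>O_alg\<close> are reduced to basis elements by this rule.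
\<close>

lemma O_carrier_induct [consumes 1, case_names Xi zero add scal]:
  assumes "p \<in> O_carrier \<alpha>"
    and Xi: "\<And>\<sigma>. \<sigma> \<in> PB \<alpha> \<Longrightarrow> P (Xi \<sigma>)"
    and zero: "P 0"
    and add: "\<And>p q. p \<in> O_carrier \<alpha> \<Longrightarrow> q \<in> O_carrier \<alpha> \<Longrightarrow> P p \<Longrightarrow> P q \<Longrightarrow> P (p + q)"
    and scal: "\<And>c p. p \<in> O_carrier \<alpha> \<Longrightarrow> P p \<Longrightarrow> P (scal c p)"
  shows "P p"
proof -
  have "(\<Sum>\<sigma>\<in>K. scal (f \<sigma>) (Xi \<sigma>)) \<in> O_carrier \<alpha> \<and> P (\<Sum>\<sigma>\<in>K. scal (f \<sigma>) (Xi \<sigma>))" if "finite K" "K \<subseteq> PB \<alpha>" for K f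
    using that
    by (induction K rule: finite_induct) (auto intro!: zero add scal Xi O_carrier_Xi)
  from this[of "PB \<alpha>" "Poly_Mapping.lookup p"] show ?thesis
    using O_carrier_expand[OF assms(1)] by simp
qed

lemma O_mult_assoc_Xi:
  assumes "\<sigma> \<in> PB \<alpha>" "\<tau> \<in> PB \<alpha>" "\<rho> \<in> PB \<alpha>"
  shows "O_mult \<alpha> \<nu> (O_mult \<alpha> \<nu> (Xi \<sigma>) (Xi \<tau>)) (Xi \<rho>) = O_mult \<alpha> \<nu> (Xi \<sigma>) (O_mult \<alpha> \<nu> (Xi \<tau>) (Xi \<rho>))"
proof -
  let ?c = "struct_const \<alpha> \<nu>"
  have "O_mult \<alpha> \<nu> (O_mult \<alpha> \<nu> (Xi \<sigma>) (Xi \<tau>)) (Xi \<rho>) =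
      (\<Sum>\<kappa>\<in>PB \<alpha>. scal (?c \<kappa> \<sigma> \<tau>) (\<Sum>\<mu>\<in>PB \<alpha>. scal (?c \<mu> \<kappa> \<rho>) (Xi \<mu>)))"
    using assms by (simp add: O_mult_Xi O_mult_sum_left O_mult_scal_left O_carrier_Xi O_carrier_scal)
  also have "\<dots> = (\<Sum>\<mu>\<in>PB \<alpha>. scal (\<Sum>\<kappa>\<in>PB \<alpha>. ?c \<kappa> \<sigma> \<tau> * ?c \<mu> \<kappa> \<rho>) (Xi \<mu>))"
    unfolding scal_sum scal_scal scal_sum_left by (rule sum.swap)
  also have "\<dots> = (\<Sum>\<mu>\<in>PB \<alpha>. scal (\<Sum>\<kappa>\<in>PB \<alpha>. ?c \<mu> \<sigma> \<kappa> * ?c \<kappa> \<tau> \<rho>) (Xi \<mu>))"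
    by (intro sum.cong refl arg_cong2[of _ _ _ _ scal] struct_const_assoc assms)
  also have "\<dots> = (\<Sum>\<kappa>\<in>PB \<alpha>. scal (?c \<kappa> \<tau> \<rho>) (\<Sum>\<mu>\<in>PB \<alpha>. scal (?c \<mu> \<sigma> \<kappa>) (Xi \<mu>)))"
    unfolding scal_sum scal_scal scal_sum_left by (subst sum.swap) (simp only: mult.commute)
  also have "\<dots> = O_mult \<alpha> \<nu> (Xi \<sigma>) (O_mult \<alpha> \<nu> (Xi \<tau>) (Xi \<rho>))"
    using assms by (simp add: O_mult_Xi O_mult_sum_right O_mult_scal_right O_carrier_Xi O_carrier_scal)
  finally show ?thesis .
qed

lemma O_mult_assoc:
  assumes "p \<in> O_carrier \<alpha>" "q \<in> O_carrier \<alpha>" "r \<in> O_carrier \<alpha>"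
  shows "O_mult \<alpha> \<nu> (O_mult \<alpha> \<nu> p q) r = O_mult \<alpha> \<nu> p (O_mult \<alpha> \<nu> q r)"
  using assms(1)
proof (induction p rule: O_carrier_induct)
  case (Xi \<sigma>)
  note \<sigma> = Xi
  show ?case
    using assms(2)
  proof (induction q rule: O_carrier_induct)
    case (Xi \<tau>)
    note \<tau> = Xi
    show ?case
      using assms(3)
    proof (induction r rule: O_carrier_induct)
      case (Xi \<rho>)
      then show ?case using \<sigma> \<tau> by (intro O_mult_assoc_Xi)
    qed (use \<sigma> \<tau> in \<open>simp_all add: O_mult_add_right O_mult_scal_right O_carrier_Xi O_carrier_mult\<close>)
  qed (use \<sigma> assms(3) in \<open>simp_all add: O_mult_add_right O_mult_scal_right O_mult_add_left
        O_mult_scal_left O_carrier_Xi O_carrier_mult\<close>)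
qed (use assms in \<open>simp_all add: O_mult_add_left O_mult_scal_left O_carrier_mult\<close>)

lemma perm_pb_iff: "perm_pb \<alpha> g j = Some i \<longleftrightarrow> j \<in> Om \<alpha> \<and> g j = i"
  by (auto simp: perm_pb_def restrict_map_def)

lemma perm_pb_PB: "g permutes Om \<alpha> \<Longrightarrow> perm_pb \<alpha> g \<in> PB \<alpha>"
  by (rule PB_I) (auto simp: perm_pb_iff permutes_in_image permutes_inj inj_eq[OF permutes_inj])

lemma dom_perm_pb: "dom (perm_pb \<alpha> g) = Om \<alpha>"
  by (auto simp: dom_def perm_pb_iff)

lemma ran_perm_pb: "g permutes Om \<alpha> \<Longrightarrow> ran (perm_pb \<alpha> g) = Om \<alpha>"
  by (auto simp: ran_def perm_pb_iff permutes_in_image) (metis permutes_def permutes_in_image)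

lemma perm_pb_comp:
  "h permutes Om \<alpha> \<Longrightarrow> perm_pb \<alpha> g \<circ>\<^sub>m perm_pb \<alpha> h = perm_pb \<alpha> (g \<circ> h)"
  by (auto simp: map_eq_iff_Some map_comp_Some_iff perm_pb_iff permutes_in_image)

text \<open>
  If \<open>dom \<sigma> \<union> ran \<tau>\<close> is all of \<open>Om \<alpha>\<close>, nothing is left to choose and the product in the structure constant is empty. Apart
  from the square of a generator \<open>\<theta>\<^sub>i\<close>, all products that are computed explicitly below are of this kind.
\<close>

lemma struct_const_full:
  assumes "\<sigma> \<in> PB \<alpha>" "\<tau> \<in> PB \<alpha>" "dom \<sigma> \<union> ran \<tau> = Om \<alpha>"
  shows "struct_const \<alpha> \<nu> \<kappa> \<sigma> \<tau> = of_bool (admissible \<kappa> \<sigma> \<tau>)"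
  using card_dom_Un_ran[OF assms(1,2)] assms(3) by (simp add: struct_const_admissible)

lemma O_mult_Xi_full:
  assumes "\<sigma> \<in> PB \<alpha>" "\<tau> \<in> PB \<alpha>" "dom \<sigma> \<union> ran \<tau> = Om \<alpha>"
    and K: "K \<subseteq> PB \<alpha>" "\<And>\<kappa>. \<kappa> \<in> PB \<alpha> \<Longrightarrow> admissible \<kappa> \<sigma> \<tau> \<longleftrightarrow> \<kappa> \<in> K"
  shows "O_mult \<alpha> \<nu> (Xi \<sigma>) (Xi \<tau>) = (\<Sum>\<kappa>\<in>K. Xi \<kappa>)"
proof -
  have "O_mult \<alpha> \<nu> (Xi \<sigma>) (Xi \<tau>) = (\<Sum>\<kappa>\<in>PB \<alpha>. scal (of_bool (\<kappa> \<in> K)) (Xi \<kappa>))"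
    using assms by (simp add: O_mult_Xi struct_const_full)
  also have "\<dots> = (\<Sum>\<kappa>\<in>K. Xi \<kappa>)"
    using K by (intro sum.mono_neutral_cong_right) auto
  finally show ?thesis .
qed

text \<open>
  The composition itself always occurs in a product of two basis elements.
\<close>

lemma admissible_comp: "admissible (\<sigma> \<circ>\<^sub>m \<tau>) \<sigma> \<tau>"
proof -
  have "dom (\<sigma> \<circ>\<^sub>m \<tau>) \<subseteq> dom \<tau>"
    by (auto simp: map_comp_Some_iff)
  moreover have "ran (\<sigma> \<circ>\<^sub>m \<tau>) \<subseteq> ran \<sigma>"
    by (auto simp: ran_def map_comp_Some_iff)
  ultimately show ?thesis
    by (simp add: admissible_def Int_absorb2)
qed

lemma O_mult_Xi_comp:
  assumes "\<sigma> \<in> PB \<alpha>" "\<tau> \<in> PB \<alpha>" "dom \<sigma> \<union> ran \<tau> = Om \<alpha>"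
    and unique: "\<And>\<kappa>. \<kappa> \<in> PB \<alpha> \<Longrightarrow> admissible \<kappa> \<sigma> \<tau> \<Longrightarrow> \<kappa> = \<sigma> \<circ>\<^sub>m \<tau>"
  shows "O_mult \<alpha> \<nu> (Xi \<sigma>) (Xi \<tau>) = Xi (\<sigma> \<circ>\<^sub>m \<tau>)"
proof -
  have "O_mult \<alpha> \<nu> (Xi \<sigma>) (Xi \<tau>) = (\<Sum>\<kappa>\<in>{\<sigma> \<circ>\<^sub>m \<tau>}. Xi \<kappa>)"
  proof (rule O_mult_Xi_full[OF assms(1-3)])
    show "{\<sigma> \<circ>\<^sub>m \<tau>} \<subseteq> PB \<alpha>"
      using map_comp_PB[OF assms(1,2)] by simp
    show "admissible \<kappa> \<sigma> \<tau> \<longleftrightarrow> \<kappa> \<in> {\<sigma> \<circ>\<^sub>m \<tau>}" if "\<kappa> \<in> PB \<alpha>" for \<kappa>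
      using unique[OF that] admissible_comp by (metis singleton_iff)
  qed
  then show ?thesis
    by simp
qed

lemma map_le_dom_eq: "f \<subseteq>\<^sub>m \<kappa> \<Longrightarrow> dom \<kappa> \<subseteq> dom f \<Longrightarrow> \<kappa> = f"
  by (metis map_le_antisym map_le_def subsetD)

lemma map_le_SomeD: "f \<subseteq>\<^sub>m \<kappa> \<Longrightarrow> f k = Some i \<Longrightarrow> \<kappa> k = Some i"
  by (metis domI map_le_def)

lemma map_le_ran_eq:
  assumes "\<kappa> \<in> PB \<alpha>" "f \<subseteq>\<^sub>m \<kappa>" "ran \<kappa> \<subseteq> ran f"
  shows "\<kappa> = f"
proof (rule map_le_dom_eq[OF assms(2)], rule subsetI)
  fix k assume "k \<in> dom \<kappa>"
  then obtain i where i: "\<kappa> k = Some i" by auto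
  then have "i \<in> ran f" using assms(3) by (auto simp: ran_def)
  then obtain k' where k': "f k' = Some i" by (auto simp: ran_def)
  then have "\<kappa> k' = Some i" using assms(2) by (rule map_le_SomeD[rotated])
  then have "k' = k" using i PB_injD[OF assms(1)] by blast
  with k' show "k \<in> dom f" by auto
qed

lemma O_mult_perm_left:
  assumes g: "g permutes Om \<alpha>" and \<tau>: "\<tau> \<in> PB \<alpha>"
  shows "O_mult \<alpha> \<nu> (Xi (perm_pb \<alpha> g)) (Xi \<tau>) = Xi (perm_pb \<alpha> g \<circ>\<^sub>m \<tau>)"
proof -
  have "\<kappa> = perm_pb \<alpha> g \<circ>\<^sub>m \<tau>" if \<kappa>: "\<kappa> \<in> PB \<alpha>" and adm: "admissible \<kappa> (perm_pb \<alpha> g) \<tau>" for \<kappa>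
  proof (rule map_le_ran_eq[OF \<kappa>])
    have "ran \<kappa> \<subseteq> Om \<alpha>"
      using \<kappa> by (simp add: PB_def)
    then show "ran \<kappa> \<subseteq> ran (perm_pb \<alpha> g \<circ>\<^sub>m \<tau>)"
      using adm ran_perm_pb[OF g] unfolding admissible_def by blast
    show "perm_pb \<alpha> g \<circ>\<^sub>m \<tau> \<subseteq>\<^sub>m \<kappa>"
      using adm by (simp add: admissible_def)
  qed
  moreover have "dom (perm_pb \<alpha> g) \<union> ran \<tau> = Om \<alpha>"
    using \<tau> by (auto simp: dom_perm_pb PB_def)
  ultimately show ?thesis
    by (intro O_mult_Xi_comp perm_pb_PB[OF g] \<tau>)
qed

lemma O_mult_perm_right:
  assumes g: "g permutes Om \<alpha>" and \<sigma>: "\<sigma> \<in> PB \<alpha>"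
  shows "O_mult \<alpha> \<nu> (Xi \<sigma>) (Xi (perm_pb \<alpha> g)) = Xi (\<sigma> \<circ>\<^sub>m perm_pb \<alpha> g)"
proof -
  have "\<kappa> = \<sigma> \<circ>\<^sub>m perm_pb \<alpha> g" if \<kappa>: "\<kappa> \<in> PB \<alpha>" and adm: "admissible \<kappa> \<sigma> (perm_pb \<alpha> g)" for \<kappa>
  proof (rule map_le_dom_eq)
    have "dom \<kappa> \<subseteq> Om \<alpha>"
      using \<kappa> by (simp add: PB_def)
    then show "dom \<kappa> \<subseteq> dom (\<sigma> \<circ>\<^sub>m perm_pb \<alpha> g)"
      using adm dom_perm_pb[of \<alpha> g] unfolding admissible_def by blast
    show "\<sigma> \<circ>\<^sub>m perm_pb \<alpha> g \<subseteq>\<^sub>m \<kappa>"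
      using adm by (simp add: admissible_def)
  qed
  moreover have "dom \<sigma> \<union> ran (perm_pb \<alpha> g) = Om \<alpha>"
    using \<sigma> by (auto simp: ran_perm_pb[OF g] PB_def)
  ultimately show ?thesis
    by (intro O_mult_Xi_comp perm_pb_PB[OF g] \<sigma>)
qed

lemma id_PB: "perm_pb \<alpha> id \<in> PB \<alpha>"
  by (rule perm_pb_PB) (rule permutes_id)

lemma id_map_comp: "\<sigma> \<in> PB \<alpha> \<Longrightarrow> perm_pb \<alpha> id \<circ>\<^sub>m \<sigma> = \<sigma>" "\<sigma> \<in> PB \<alpha> \<Longrightarrow> \<sigma> \<circ>\<^sub>m perm_pb \<alpha> id = \<sigma>"
  by (auto simp: map_eq_iff_Some map_comp_Some_iff perm_pb_iff dest: PB_OmD)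

lemma O_mult_one:
  assumes "p \<in> O_carrier \<alpha>"
  shows "O_mult \<alpha> \<nu> (Xi (perm_pb \<alpha> id)) p = p" "O_mult \<alpha> \<nu> p (Xi (perm_pb \<alpha> id)) = p"
  using assms
  by (induction p rule: O_carrier_induct)
    (simp_all add: O_mult_perm_left O_mult_perm_right permutes_id id_map_comp id_PB O_carrier_Xi
      O_mult_add_left O_mult_add_right O_mult_scal_left O_mult_scal_right)

lemma O_alg_simps [simp]:
  "carrier (O_alg \<alpha> \<nu>) = O_carrier \<alpha>" "monoid.mult (O_alg \<alpha> \<nu>) = O_mult \<alpha> \<nu>"
  "monoid.one (O_alg \<alpha> \<nu>) = Xi (perm_pb \<alpha> id)" "ring.zero (O_alg \<alpha> \<nu>) = 0"
  "ring.add (O_alg \<alpha> \<nu>) = (+)" "module.smult (O_alg \<alpha> \<nu>) = scal"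
  by (simp_all add: O_alg_def O_carrier_def)

lemma ring_O_alg: "ring (O_alg \<alpha> \<nu>)"
proof (intro ringI abelian_groupI monoidI, unfold O_alg_simps)
  show "\<exists>q\<in>O_carrier \<alpha>. q + p = 0" if "p \<in> O_carrier \<alpha>" for p
    using that by (intro bexI[of _ "0 - p"] O_carrier_diff O_carrier_0) simp_all
qed (auto simp: O_mult_assoc O_mult_one O_mult_add_left O_mult_add_right id_PB algebra_simps)

section \<open>The defining relations in the algebra with basis PB\<close>

definition id_off :: "nat \<Rightarrow> nat set \<Rightarrow> pbij" where
  "id_off \<alpha> J = Some |` (Om \<alpha> - J)"

lemma id_off_iff: "id_off \<alpha> J k = Some i \<longleftrightarrow> k \<in> Om \<alpha> - J \<and> i = k"
  by (auto simp: id_off_def restrict_map_def)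

lemma dom_id_off: "dom (id_off \<alpha> J) = Om \<alpha> - J"
  by (auto simp: id_off_def)

lemma ran_id_off: "ran (id_off \<alpha> J) = Om \<alpha> - J"
  by (auto simp: ran_def id_off_iff)

lemma id_off_PB: "id_off \<alpha> J \<in> PB \<alpha>"
  by (rule PB_I) (auto simp: id_off_iff)

lemma rk_id_off: "J \<subseteq> Om \<alpha> \<Longrightarrow> rk (id_off \<alpha> J) = \<alpha> - card J"
  by (simp add: rk_def dom_id_off card_Diff_subset finite_subset[OF _ finite_Om])

lemma T_eq_id_off: "T \<alpha> i = id_off \<alpha> {i}"
  by (simp add: T_def id_off_def)

lemma perm_pb_id_eq: "perm_pb \<alpha> id = id_off \<alpha> {}"
  by (simp add: perm_pb_def id_off_def)

lemma id_off_comp: "id_off \<alpha> I \<circ>\<^sub>m id_off \<alpha> J = id_off \<alpha> (I \<union> J)"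
  by (auto simp: map_eq_iff_Some map_comp_Some_iff id_off_iff)

lemma theta_carrier: "theta \<alpha> i \<in> O_carrier \<alpha>"
  by (simp add: theta_def T_eq_id_off O_carrier_Xi id_off_PB)

lemma admissible_T_T:
  assumes "j \<in> Om \<alpha>" and \<kappa>: "\<kappa> \<in> PB \<alpha>"
  shows "admissible \<kappa> (T \<alpha> j) (T \<alpha> j) \<longleftrightarrow> \<kappa> \<in> {T \<alpha> j, perm_pb \<alpha> id}"
proof
  assume "admissible \<kappa> (T \<alpha> j) (T \<alpha> j)"
  then have off: "\<kappa> k = Some k" if "k \<in> Om \<alpha> - {j}" for k
    using that admissible_extends[of \<kappa> "T \<alpha> j" "T \<alpha> j" k k k] by (simp add: T_eq_id_off id_off_iff)
  have at: "i = j" if "\<kappa> j = Some i" for i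
    using off[of i] PB_OmD[OF \<kappa> that] PB_injD[OF \<kappa> that, of i] by auto
  show "\<kappa> \<in> {T \<alpha> j, perm_pb \<alpha> id}"
  proof (cases "\<kappa> j")
    case None
    have "\<kappa> k = T \<alpha> j k" for k
      using None off[of k] PB_OmD(1)[OF \<kappa>, of k]
      by (cases "\<kappa> k") (auto simp: T_def restrict_map_def)
    then show ?thesis by auto
  next
    case (Some i)
    have "\<kappa> k = perm_pb \<alpha> id k" for k
      using Some at[OF Some] off[of k] PB_OmD(1)[OF \<kappa>, of k] assms(1)
      by (cases "k = j"; cases "\<kappa> k") (auto simp: perm_pb_def restrict_map_def)
    then show ?thesis by auto
  qed
next
  assume "\<kappa> \<in> {T \<alpha> j, perm_pb \<alpha> id}"
  then consider "\<kappa> = id_off \<alpha> {j}" | "\<kappa> = id_off \<alpha> {}"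
    by (auto simp: T_eq_id_off perm_pb_id_eq)
  then show "admissible \<kappa> (T \<alpha> j) (T \<alpha> j)"
    by cases (auto intro!: admissibleI simp: T_eq_id_off id_off_iff)
qed

lemma theta_square:
  assumes "j \<in> Om \<alpha>"
  shows "O_mult \<alpha> \<nu> (theta \<alpha> j) (theta \<alpha> j) =
    scal (\<nu> - 1) (theta \<alpha> j) + scal \<nu> (Xi (perm_pb \<alpha> id))"
proof -
  let ?c = "\<lambda>\<kappa>. struct_const \<alpha> \<nu> \<kappa> (T \<alpha> j) (T \<alpha> j)"
  have TPB: "T \<alpha> j \<in> PB \<alpha>"
    by (simp add: T_eq_id_off id_off_PB)
  have \<alpha>: "\<alpha> \<noteq> 0"
    using assms by (auto simp: Om_def)
  have rkT: "rk (T \<alpha> j) = \<alpha> - 1"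
    using rk_id_off[of "{j}" \<alpha>] assms by (simp add: T_eq_id_off)
  have rk1: "rk (perm_pb \<alpha> id) = \<alpha>"
    by (simp add: rk_def dom_perm_pb)
  have ne: "T \<alpha> j \<noteq> perm_pb \<alpha> id"
    using rkT rk1 \<alpha> by auto
  have len: "\<alpha> + rk (T \<alpha> j \<circ>\<^sub>m T \<alpha> j) - rk (T \<alpha> j) - rk (T \<alpha> j) = 1"
    using \<alpha> id_off_comp[of \<alpha> "{j}" "{j}"] rkT by (simp add: T_eq_id_off)
  have c: "?c \<kappa> = (if \<kappa> \<in> {T \<alpha> j, perm_pb \<alpha> id} then \<nu> - of_nat \<alpha> + of_nat (rk \<kappa>) else 0)"
    if "\<kappa> \<in> PB \<alpha>" for \<kappa>
    using admissible_T_T[OF assms that] unfolding struct_const_admissible len by simp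
  have "O_mult \<alpha> \<nu> (theta \<alpha> j) (theta \<alpha> j) = (\<Sum>\<kappa>\<in>PB \<alpha>. scal (?c \<kappa>) (Xi \<kappa>))"
    using TPB by (simp add: theta_def O_mult_Xi)
  also have "\<dots> = (\<Sum>\<kappa>\<in>{T \<alpha> j, perm_pb \<alpha> id}. scal (\<nu> - of_nat \<alpha> + of_nat (rk \<kappa>)) (Xi \<kappa>))"
    using TPB id_PB[of \<alpha>] by (intro sum.mono_neutral_cong_right) (auto simp: c)
  also have "\<dots> = scal (\<nu> - 1) (theta \<alpha> j) + scal \<nu> (Xi (perm_pb \<alpha> id))"
    using ne \<alpha> by (simp add: rkT rk1 theta_def of_nat_diff)
  finally show ?thesis .
qed

lemma id_off_upd_PB: "i \<in> Om \<alpha> \<Longrightarrow> j \<in> Om \<alpha> \<Longrightarrow> (id_off \<alpha> {i, j})(i \<mapsto> j) \<in> PB \<alpha>"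
  by (rule PB_I) (auto simp: id_off_iff split: if_splits)

text \<open>
  The partial bijection \<open>(id_off \<alpha> {i, j})(i \<mapsto> j)\<close> is the composition of the transposition of \<open>i\<close> and \<open>j\<close> with \<open>T \<alpha> j\<close>. The
  difference of the two products of \<open>\<theta>\<^sub>i\<close> and \<open>\<theta>\<^sub>j\<close> in different orders thus is the commutator demanded by the relations.
\<close>

lemma theta_mult:
  assumes ij: "i \<in> Om \<alpha>" "j \<in> Om \<alpha>" "i \<noteq> j"
  shows "O_mult \<alpha> \<nu> (theta \<alpha> j) (theta \<alpha> i) = Xi (id_off \<alpha> {i, j}) + Xi ((id_off \<alpha> {i, j})(i \<mapsto> j))"
proof -
  let ?K = "{id_off \<alpha> {i, j}, (id_off \<alpha> {i, j})(i \<mapsto> j)}"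
  have "O_mult \<alpha> \<nu> (Xi (id_off \<alpha> {j})) (Xi (id_off \<alpha> {i})) = (\<Sum>\<kappa>\<in>?K. Xi \<kappa>)"
  proof (rule O_mult_Xi_full[OF id_off_PB id_off_PB])
    show "dom (id_off \<alpha> {j}) \<union> ran (id_off \<alpha> {i}) = Om \<alpha>"
      using ij by (auto simp: dom_id_off ran_id_off)
    show "?K \<subseteq> PB \<alpha>"
      using ij id_off_upd_PB by (simp add: id_off_PB)
    fix \<kappa> assume \<kappa>: "\<kappa> \<in> PB \<alpha>"
    show "admissible \<kappa> (id_off \<alpha> {j}) (id_off \<alpha> {i}) \<longleftrightarrow> \<kappa> \<in> ?K"
    proof
      assume adm: "admissible \<kappa> (id_off \<alpha> {j}) (id_off \<alpha> {i})"
      have off: "\<kappa> k = Some k" if "k \<in> Om \<alpha> - {i, j}" for k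
        using that admissible_extends[OF adm, of k k k] by (simp add: id_off_iff)
      have atj: "\<kappa> j = None"
        using admissible_dom[OF adm, of j _ j] ij by (cases "\<kappa> j") (simp_all add: id_off_iff)
      have ati: "m = j" if "\<kappa> i = Some m" for m
        using admissible_ran[OF adm that _ \<kappa> id_off_PB, of m] PB_OmD[OF \<kappa> that]
        by (auto simp: id_off_iff)
      show "\<kappa> \<in> ?K"
      proof (cases "\<kappa> i")
        case None
        have "\<kappa> k = id_off \<alpha> {i, j} k" for k
          using None atj off[of k] PB_OmD(1)[OF \<kappa>, of k]
          by (cases "k \<in> {i, j}"; cases "\<kappa> k") (auto simp: id_off_def restrict_map_def)
        then show ?thesis by auto
      next
        case (Some m)
        have "\<kappa> k = ((id_off \<alpha> {i, j})(i \<mapsto> j)) k" for k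
          using Some ati[OF Some] atj off[of k] PB_OmD(1)[OF \<kappa>, of k]
          by (cases "k \<in> {i, j}"; cases "\<kappa> k") (auto simp: id_off_def restrict_map_def)
        then show ?thesis by auto
      qed
    next
      assume "\<kappa> \<in> ?K"
      then show "admissible \<kappa> (id_off \<alpha> {j}) (id_off \<alpha> {i})"
        using ij by (intro admissibleI) (auto simp: id_off_iff split: if_splits)
    qed
  qed
  moreover have "id_off \<alpha> {i, j} \<noteq> (id_off \<alpha> {i, j})(i \<mapsto> j)"
    using ij by (auto simp: fun_eq_iff id_off_def restrict_map_def)
  ultimately show ?thesis
    by (simp add: theta_def T_eq_id_off)
qed

text \<open>
  Multiplication by the transposition of \<open>i\<close> and \<open>j\<close> fixes \<open>Xi (id_off \<alpha> {i, j})\<close> and exchanges the other summand of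
  \<open>\<theta>\<^sub>j \<theta>\<^sub>i\<close> with \<open>\<theta>\<^sub>j\<close>. So it fixes \<open>\<theta>\<^sub>j (\<theta>\<^sub>i + 1)\<close>, which is the last relation.
\<close>

lemma transpose_theta:
  assumes ij: "i \<in> Om \<alpha>" "j \<in> Om \<alpha>" "i \<noteq> j"
  shows "O_mult \<alpha> \<nu> (Xi (perm_pb \<alpha> (Transposition.transpose i j))) (theta \<alpha> j) = Xi ((id_off \<alpha> {i, j})(i \<mapsto> j))"
    (is "?t1 = _")
    and "O_mult \<alpha> \<nu> (Xi (perm_pb \<alpha> (Transposition.transpose i j))) (theta \<alpha> i) = Xi ((id_off \<alpha> {i, j})(j \<mapsto> i))"
    and "O_mult \<alpha> \<nu> (Xi (perm_pb \<alpha> (Transposition.transpose i j))) (Xi (id_off \<alpha> {i, j})) = Xi (id_off \<alpha> {i, j})"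
    and "O_mult \<alpha> \<nu> (Xi (perm_pb \<alpha> (Transposition.transpose i j))) (Xi ((id_off \<alpha> {i, j})(i \<mapsto> j))) = theta \<alpha> j"
proof -
  have t: "Transposition.transpose i j permutes Om \<alpha>"
    using ij by (simp add: permutes_swap_id)
  note mult = O_mult_perm_left[OF t]
  have eqs: "perm_pb \<alpha> (Transposition.transpose i j) \<circ>\<^sub>m id_off \<alpha> {j} = (id_off \<alpha> {i, j})(i \<mapsto> j)"
    "perm_pb \<alpha> (Transposition.transpose i j) \<circ>\<^sub>m id_off \<alpha> {i} = (id_off \<alpha> {i, j})(j \<mapsto> i)"
    "perm_pb \<alpha> (Transposition.transpose i j) \<circ>\<^sub>m id_off \<alpha> {i, j} = id_off \<alpha> {i, j}"
    "perm_pb \<alpha> (Transposition.transpose i j) \<circ>\<^sub>m (id_off \<alpha> {i, j})(i \<mapsto> j) = id_off \<alpha> {j}"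
    using ij by (auto simp: map_eq_iff_Some map_comp_Some_iff perm_pb_iff id_off_iff Transposition.transpose_def)
  show "?t1 = Xi ((id_off \<alpha> {i, j})(i \<mapsto> j))"
    "O_mult \<alpha> \<nu> (Xi (perm_pb \<alpha> (Transposition.transpose i j))) (theta \<alpha> i) = Xi ((id_off \<alpha> {i, j})(j \<mapsto> i))"
    "O_mult \<alpha> \<nu> (Xi (perm_pb \<alpha> (Transposition.transpose i j))) (Xi (id_off \<alpha> {i, j})) = Xi (id_off \<alpha> {i, j})"
    "O_mult \<alpha> \<nu> (Xi (perm_pb \<alpha> (Transposition.transpose i j))) (Xi ((id_off \<alpha> {i, j})(i \<mapsto> j))) = theta \<alpha> j"
    using ij by (simp_all add: theta_def T_eq_id_off mult id_off_PB id_off_upd_PB eqs)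
qed

lemma perm_theta_perm:
  assumes g: "g permutes Om \<alpha>" and i: "i \<in> Om \<alpha>"
  shows "O_mult \<alpha> \<nu> (O_mult \<alpha> \<nu> (Xi (perm_pb \<alpha> g)) (theta \<alpha> i)) (Xi (perm_pb \<alpha> (inv_into UNIV g))) = theta \<alpha> (g i)"
proof -
  note inv = permutes_inv[OF g]
  have "(perm_pb \<alpha> g \<circ>\<^sub>m id_off \<alpha> {i}) \<circ>\<^sub>m perm_pb \<alpha> (inv_into UNIV g) = id_off \<alpha> {g i}"
    using permutes_in_image[OF inv] permutes_inverses[OF g]
    by (auto simp: map_eq_iff_Some map_comp_Some_iff perm_pb_iff id_off_iff)
  then show ?thesis
    by (simp add: theta_def T_eq_id_off O_mult_perm_left[OF g id_off_PB]
        O_mult_perm_right[OF inv map_comp_PB[OF perm_pb_PB[OF g] id_off_PB]])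
qed

section \<open>Evaluation of the free algebra\<close>

definition free_carrier :: "'g set \<Rightarrow> ('g word \<Rightarrow>\<^sub>0 complex) set" where
  "free_carrier G = {p. \<forall>w \<in> Poly_Mapping.keys p. set (letters w) \<subseteq> G}"

lemma free_alg_simps [simp]:
  "carrier (free_alg G) = free_carrier G" "monoid.mult (free_alg G) = (*)"
  "monoid.one (free_alg G) = 1" "ring.zero (free_alg G) = 0"
  "ring.add (free_alg G) = (+)" "module.smult (free_alg G) = scal"
  by (simp_all add: free_alg_def free_carrier_def)

lemma free_carrier_mult [intro]: "p \<in> free_carrier G \<Longrightarrow> q \<in> free_carrier G \<Longrightarrow> p * q \<in> free_carrier G"
  using monoid.m_closed[OF ring.is_monoid[OF ring_free_alg[of G]], of p q] by simp

lemma free_carrier_add [intro]: "p \<in> free_carrier G \<Longrightarrow> q \<in> free_carrier G \<Longrightarrow> p + q \<in> free_carrier G"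
  using Poly_Mapping.keys_add[of p q] unfolding free_carrier_def by blast

lemma free_carrier_diff [intro]: "p \<in> free_carrier G \<Longrightarrow> q \<in> free_carrier G \<Longrightarrow> p - q \<in> free_carrier G"
  using free_carrier_add[of p G "- q"] by (simp add: free_carrier_def)

lemma free_carrier_0 [intro]: "0 \<in> free_carrier G"
  and free_carrier_1 [intro]: "1 \<in> free_carrier G"
  by (simp_all add: free_carrier_def zero_word_def)

lemma free_carrier_scal [intro]: "p \<in> free_carrier G \<Longrightarrow> scal c p \<in> free_carrier G"
  using keys_scal[of c p] by (auto simp: free_carrier_def)

lemma free_carrier_sum [intro]:
  "(\<And>i. i \<in> A \<Longrightarrow> f i \<in> free_carrier G) \<Longrightarrow> (\<Sum>i\<in>A. f i) \<in> free_carrier G"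
  by (induction A rule: infinite_finite_induct) auto

lemma free_carrier_gen: "x \<in> G \<Longrightarrow> free_gen x \<in> free_carrier G"
  by (simp add: free_carrier_def free_gen_def)

lemma gens_simps [simp]: "Gen_A g \<in> gens \<alpha> \<longleftrightarrow> g permutes Om \<alpha>" "Gen_Theta i \<in> gens \<alpha> \<longleftrightarrow> i \<in> Om \<alpha>"
  by (auto simp: gens_def)

lemma free_carrier_fA: "g permutes Om \<alpha> \<Longrightarrow> fA g \<in> free_carrier (gens \<alpha>)"
  and free_carrier_fTheta: "i \<in> Om \<alpha> \<Longrightarrow> fTheta i \<in> free_carrier (gens \<alpha>)"
  by (simp_all add: free_carrier_gen)

primrec gen_image :: "nat \<Rightarrow> gen \<Rightarrow> (pbij \<Rightarrow>\<^sub>0 complex)" where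
  "gen_image \<alpha> (Gen_A g) = Xi (perm_pb \<alpha> g)"
| "gen_image \<alpha> (Gen_Theta i) = theta \<alpha> i"

primrec word_image :: "nat \<Rightarrow> complex \<Rightarrow> gen list \<Rightarrow> (pbij \<Rightarrow>\<^sub>0 complex)" where
  "word_image \<alpha> \<nu> [] = Xi (perm_pb \<alpha> id)"
| "word_image \<alpha> \<nu> (x # xs) = O_mult \<alpha> \<nu> (gen_image \<alpha> x) (word_image \<alpha> \<nu> xs)"

definition free_hom :: "nat \<Rightarrow> complex \<Rightarrow> (gen word \<Rightarrow>\<^sub>0 complex) \<Rightarrow> (pbij \<Rightarrow>\<^sub>0 complex)" where
  "free_hom \<alpha> \<nu> p = (\<Sum>w\<in>Poly_Mapping.keys p. scal (Poly_Mapping.lookup p w) (word_image \<alpha> \<nu> (letters w)))"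

lemma gen_image_carrier: "x \<in> gens \<alpha> \<Longrightarrow> gen_image \<alpha> x \<in> O_carrier \<alpha>"
  by (cases x) (simp_all add: perm_pb_PB O_carrier_Xi theta_carrier)

lemma word_image_carrier: "set xs \<subseteq> gens \<alpha> \<Longrightarrow> word_image \<alpha> \<nu> xs \<in> O_carrier \<alpha>"
  by (induction xs) (auto simp: id_PB gen_image_carrier)

lemma word_image_append:
  assumes "set xs \<subseteq> gens \<alpha>" "set ys \<subseteq> gens \<alpha>"
  shows "word_image \<alpha> \<nu> (xs @ ys) = O_mult \<alpha> \<nu> (word_image \<alpha> \<nu> xs) (word_image \<alpha> \<nu> ys)"
  using assms
  by (induction xs) (simp_all add: O_mult_one word_image_carrier gen_image_carrier O_mult_assoc)

lemma free_hom_carrier: "p \<in> free_carrier (gens \<alpha>) \<Longrightarrow> free_hom \<alpha> \<nu> p \<in> O_carrier \<alpha>"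
  unfolding free_hom_def free_carrier_def by (auto intro!: word_image_carrier)

lemma free_hom_superset:
  assumes "finite K" "Poly_Mapping.keys p \<subseteq> K"
  shows "free_hom \<alpha> \<nu> p = (\<Sum>w\<in>K. scal (Poly_Mapping.lookup p w) (word_image \<alpha> \<nu> (letters w)))"
  unfolding free_hom_def using assms by (intro sum.mono_neutral_left) (auto simp: in_keys_iff)

lemma free_hom_add: "free_hom \<alpha> \<nu> (p + q) = free_hom \<alpha> \<nu> p + free_hom \<alpha> \<nu> q"
proof -
  let ?K = "Poly_Mapping.keys p \<union> Poly_Mapping.keys q"
  have "Poly_Mapping.keys (p + q) \<subseteq> ?K"
    by (rule Poly_Mapping.keys_add)
  then show ?thesis
    by (simp add: free_hom_superset[of ?K] lookup_add scal_add_left sum.distrib)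
qed

lemma free_hom_scal: "free_hom \<alpha> \<nu> (scal c p) = scal c (free_hom \<alpha> \<nu> p)"
  unfolding free_hom_superset[OF finite_keys keys_scal[of c p]] free_hom_def[of _ _ p]
  by (simp add: scal_sum scal_scal)

lemma free_hom_0 [simp]: "free_hom \<alpha> \<nu> 0 = 0"
  by (simp add: free_hom_def)

lemma free_hom_diff: "free_hom \<alpha> \<nu> (p - q) = free_hom \<alpha> \<nu> p - free_hom \<alpha> \<nu> q"
  using free_hom_add[of \<alpha> \<nu> "p - q" q] by simp

lemma free_hom_sum: "free_hom \<alpha> \<nu> (\<Sum>i\<in>A. f i) = (\<Sum>i\<in>A. free_hom \<alpha> \<nu> (f i))"
  by (induction A rule: infinite_finite_induct) (simp_all add: free_hom_add)

lemma free_hom_single: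
  "free_hom \<alpha> \<nu> (Poly_Mapping.single w c) = scal c (word_image \<alpha> \<nu> (letters w))"
  by (simp add: free_hom_superset[of "{w}"])

lemma free_hom_mult:
  assumes p: "p \<in> free_carrier (gens \<alpha>)" and q: "q \<in> free_carrier (gens \<alpha>)"
  shows "free_hom \<alpha> \<nu> (p * q) = O_mult \<alpha> \<nu> (free_hom \<alpha> \<nu> p) (free_hom \<alpha> \<nu> q)"
proof -
  let ?P = "Poly_Mapping.keys p" and ?Q = "Poly_Mapping.keys q"
  let ?p = "Poly_Mapping.lookup p" and ?q = "Poly_Mapping.lookup q"
  let ?W = "\<lambda>w. word_image \<alpha> \<nu> (letters w)"
  have P: "set (letters u) \<subseteq> gens \<alpha>" "?W u \<in> O_carrier \<alpha>" if "u \<in> ?P" for u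
    using that p word_image_carrier by (auto simp: free_carrier_def)
  have Q: "set (letters u) \<subseteq> gens \<alpha>" "?W u \<in> O_carrier \<alpha>" if "u \<in> ?Q" for u
    using that q word_image_carrier by (auto simp: free_carrier_def)
  have "p * q = (\<Sum>u\<in>?P. Poly_Mapping.single u (?p u)) * (\<Sum>v\<in>?Q. Poly_Mapping.single v (?q v))"
    using sum_single_keys[of ?P p] sum_single_keys[of ?Q q] by simp
  also have "\<dots> = (\<Sum>u\<in>?P. \<Sum>v\<in>?Q. Poly_Mapping.single (u + v) (?p u * ?q v))"
    by (simp add: sum_product mult_single)
  finally have "free_hom \<alpha> \<nu> (p * q) = (\<Sum>u\<in>?P. \<Sum>v\<in>?Q. scal (?p u * ?q v) (?W (u + v)))"
    by (simp add: free_hom_sum free_hom_single)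
  also have "\<dots> = (\<Sum>u\<in>?P. \<Sum>v\<in>?Q. O_mult \<alpha> \<nu> (scal (?p u) (?W u)) (scal (?q v) (?W v)))"
    by (intro sum.cong refl) (simp add: plus_word_def word_image_append P Q O_mult_scal_left
        O_mult_scal_right O_carrier_scal scal_scal mult.commute)
  also have "\<dots> = (\<Sum>u\<in>?P. O_mult \<alpha> \<nu> (scal (?p u) (?W u)) (free_hom \<alpha> \<nu> q))"
    unfolding free_hom_def by (intro sum.cong refl O_mult_sum_right[symmetric] O_carrier_scal P Q)
  also have "\<dots> = O_mult \<alpha> \<nu> (free_hom \<alpha> \<nu> p) (free_hom \<alpha> \<nu> q)"
    using free_hom_carrier[OF q] unfolding free_hom_def[of _ _ p]
    by (intro O_mult_sum_left[symmetric] O_carrier_scal P)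
  finally show ?thesis .
qed

lemma free_hom_one: "free_hom \<alpha> \<nu> 1 = Xi (perm_pb \<alpha> id)"
  using free_hom_single[of \<alpha> \<nu> 0 1, unfolded single_one] by (simp add: zero_word_def)

lemma free_hom_gen: "x \<in> gens \<alpha> \<Longrightarrow> free_hom \<alpha> \<nu> (free_gen x) = gen_image \<alpha> x"
  by (simp add: free_gen_def free_hom_single O_mult_one gen_image_carrier)

lemma ring_hom_ring_free_hom: "ring_hom_ring (free_alg (gens \<alpha>)) (O_alg \<alpha> \<nu>) (free_hom \<alpha> \<nu>)"
  by (intro ring_hom_ringI ring_free_alg ring_O_alg)
    (simp_all add: free_hom_carrier free_hom_mult free_hom_add free_hom_one)

lemma rels_carrier: "rels \<alpha> \<nu> \<subseteq> free_carrier (gens \<alpha>)"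
  unfolding rels_def
  by (auto intro!: free_carrier_add free_carrier_diff free_carrier_mult free_carrier_scal free_carrier_1
      free_carrier_fA free_carrier_fTheta permutes_id permutes_compose permutes_inv permutes_swap_id
      simp: permutes_in_image)

lemma free_hom_rels:
  assumes "r \<in> rels \<alpha> \<nu>"
  shows "free_hom \<alpha> \<nu> r = 0"
proof -
  note C = free_carrier_mult free_carrier_fA free_carrier_fTheta free_carrier_add free_carrier_diff
    permutes_id permutes_inv permutes_swap_id
  note O = O_carrier_Xi O_carrier_add O_carrier_diff O_carrier_mult theta_carrier perm_pb_PB id_off_PB id_off_upd_PB id_PB
  note hom = free_hom_diff free_hom_add free_hom_scal free_hom_mult free_hom_gen free_hom_one
  from assms consider
      "r = fA id - 1"
    | g h where "g permutes Om \<alpha>" "h permutes Om \<alpha>" "r = fA g * fA h - fA (g \<circ> h)"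
    | g i where "g permutes Om \<alpha>" "i \<in> Om \<alpha>" "r = fA g * fTheta i * fA (inv_into UNIV g) - fTheta (g i)"
    | j where "j \<in> Om \<alpha>" "r = fTheta j * fTheta j - (scal (\<nu> - 1) (fTheta j) + scal \<nu> (fA id))"
    | i j where "i \<in> Om \<alpha>" "j \<in> Om \<alpha>" "i \<noteq> j"
        "r = (fTheta j * fTheta i - fTheta i * fTheta j) - fA (Transposition.transpose i j) * (fTheta j - fTheta i)"
    | i j where "i \<in> Om \<alpha>" "j \<in> Om \<alpha>" "i \<noteq> j"
        "r = (fA (Transposition.transpose i j) - fA id) * fTheta j * (fTheta i + fA id)"
    unfolding rels_def by blast
  then show ?thesis
  proof cases
    case 1
    then show ?thesis
      by (simp add: hom permutes_id)
  next
    case (2 g h)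
    then show ?thesis
      by (simp add: hom C O_mult_perm_left perm_pb_PB perm_pb_comp permutes_compose)
  next
    case (3 g i)
    then show ?thesis
      by (simp add: hom C perm_theta_perm permutes_in_image)
  next
    case (4 j)
    then show ?thesis
      by (simp add: hom C theta_square)
  next
    case (5 i j)
    have "theta \<alpha> i \<in> O_carrier \<alpha>" "theta \<alpha> j \<in> O_carrier \<alpha>"
      by (simp_all add: theta_carrier)
    then show ?thesis
      using 5 theta_mult[of i \<alpha> j \<nu>] theta_mult[of j \<alpha> i \<nu>]
      by (simp add: hom C O transpose_theta O_mult_diff_right insert_commute)
  next
    case (6 i j)
    let ?t = "Xi (perm_pb \<alpha> (Transposition.transpose i j))" and ?e = "Xi (perm_pb \<alpha> id)"
    let ?x = "O_mult \<alpha> \<nu> (theta \<alpha> j) (theta \<alpha> i) + theta \<alpha> j"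
    have t: "Transposition.transpose i j permutes Om \<alpha>"
      using 6 by (simp add: permutes_swap_id)
    have "free_hom \<alpha> \<nu> r = O_mult \<alpha> \<nu> (O_mult \<alpha> \<nu> (?t - ?e) (theta \<alpha> j)) (theta \<alpha> i + ?e)"
      using 6 by (simp add: hom C)
    also have "\<dots> = O_mult \<alpha> \<nu> (?t - ?e) ?x"
      using t by (simp add: O_mult_assoc O O_mult_add_right O_mult_one)
    also have "\<dots> = 0"
      using 6 t by (simp add: theta_mult O_mult_diff_left O_mult_add_right O O_mult_one transpose_theta)
    finally show ?thesis .
  qed
qed

lemma ideal_rel_ideal: "ideal (rel_ideal \<alpha> \<nu>) (free_alg (gens \<alpha>))"
  unfolding rel_ideal_def
  by (rule ring.genideal_ideal[OF ring_free_alg]) (simp add: rels_carrier)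

lemma rels_rel_ideal: "r \<in> rels \<alpha> \<nu> \<Longrightarrow> r \<in> rel_ideal \<alpha> \<nu>"
  unfolding rel_ideal_def
  using ring.genideal_self[OF ring_free_alg, of "rels \<alpha> \<nu>" "gens \<alpha>"] rels_carrier by auto

lemma free_hom_rel_ideal:
  assumes "p \<in> rel_ideal \<alpha> \<nu>"
  shows "free_hom \<alpha> \<nu> p = 0"
proof -
  let ?K = "a_kernel (free_alg (gens \<alpha>)) (O_alg \<alpha> \<nu>) (free_hom \<alpha> \<nu>)"
  have "rels \<alpha> \<nu> \<subseteq> ?K"
    using rels_carrier[of \<alpha> \<nu>] free_hom_rels by (auto simp: a_kernel_def')
  then have "rel_ideal \<alpha> \<nu> \<subseteq> ?K"
    unfolding rel_ideal_def
    by (rule ring.genideal_minimal[OF ring_free_alg ring_hom_ring.kernel_is_ideal[OF ring_hom_ring_free_hom]])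
  then show ?thesis
    using assms by (auto simp: a_kernel_def')
qed

section \<open>Calculations modulo the ideal of relations\<close>

abbreviation Fr :: "nat \<Rightarrow> (gen word \<Rightarrow>\<^sub>0 complex) set" where
  "Fr \<alpha> \<equiv> free_carrier (gens \<alpha>)"

lemma rel_ideal_carrier: "p \<in> rel_ideal \<alpha> \<nu> \<Longrightarrow> p \<in> Fr \<alpha>"
  using additive_subgroup.a_Hcarr[OF ideal.axioms(1)[OF ideal_rel_ideal]] by fastforce

lemma rel_ideal_0: "0 \<in> rel_ideal \<alpha> \<nu>"
  using additive_subgroup.zero_closed[OF ideal.axioms(1)[OF ideal_rel_ideal[of \<alpha> \<nu>]]] by simp

lemma rel_ideal_add: "p \<in> rel_ideal \<alpha> \<nu> \<Longrightarrow> q \<in> rel_ideal \<alpha> \<nu> \<Longrightarrow> p + q \<in> rel_ideal \<alpha> \<nu>"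
  using additive_subgroup.a_closed[OF ideal.axioms(1)[OF ideal_rel_ideal[of \<alpha> \<nu>]], of p q] by simp

lemma rel_ideal_mult_left: "p \<in> rel_ideal \<alpha> \<nu> \<Longrightarrow> q \<in> Fr \<alpha> \<Longrightarrow> q * p \<in> rel_ideal \<alpha> \<nu>"
  using ideal.I_l_closed[OF ideal_rel_ideal[of \<alpha> \<nu>], of p q] by simp

lemma rel_ideal_mult_right: "p \<in> rel_ideal \<alpha> \<nu> \<Longrightarrow> q \<in> Fr \<alpha> \<Longrightarrow> p * q \<in> rel_ideal \<alpha> \<nu>"
  using ideal.I_r_closed[OF ideal_rel_ideal[of \<alpha> \<nu>], of p q] by simp

lemma rel_ideal_scal: "p \<in> rel_ideal \<alpha> \<nu> \<Longrightarrow> scal c p \<in> rel_ideal \<alpha> \<nu>"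
  using rel_ideal_mult_left[of p \<alpha> \<nu> "scal c 1"] by (simp add: mult_scal_left free_carrier_scal free_carrier_1)

lemma rel_ideal_diff: "p \<in> rel_ideal \<alpha> \<nu> \<Longrightarrow> q \<in> rel_ideal \<alpha> \<nu> \<Longrightarrow> p - q \<in> rel_ideal \<alpha> \<nu>"
  using rel_ideal_add[of p \<alpha> \<nu> "scal (- 1) q"] rel_ideal_scal[of q \<alpha> \<nu> "- 1"] by (simp add: scal_minus_one)

lemma fA_id_cong: "fA id - 1 \<in> rel_ideal \<alpha> \<nu>"
  by (rule rels_rel_ideal) (simp add: rels_def)

lemma fA_mult_cong:
  "g permutes Om \<alpha> \<Longrightarrow> h permutes Om \<alpha> \<Longrightarrow> fA g * fA h - fA (g \<circ> h) \<in> rel_ideal \<alpha> \<nu>"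
  by (rule rels_rel_ideal) (unfold rels_def, blast)

text \<open>
  The conjugation relation in the form used to move all factors \<open>\<Theta>\<close> to the right of a factor \<open>A(g)\<close>.
\<close>

lemma fTheta_fA_cong:
  assumes g: "g permutes Om \<alpha>" and i: "i \<in> Om \<alpha>"
  shows "fTheta (g i) * fA g - fA g * fTheta i \<in> rel_ideal \<alpha> \<nu>"
proof -
  let ?h = "inv_into UNIV g"
  have h: "?h permutes Om \<alpha>"
    using g by (rule permutes_inv)
  have conj: "fA g * fTheta i * fA ?h - fTheta (g i) \<in> rel_ideal \<alpha> \<nu>"
    by (rule rels_rel_ideal) (use g i in \<open>unfold rels_def, blast\<close>)
  have "fA ?h * fA g - fA id \<in> rel_ideal \<alpha> \<nu>"
    using fA_mult_cong[OF h g, of \<nu>] by (simp add: permutes_inv_o[OF g])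
  then have "(fA ?h * fA g - fA id) + (fA id - 1) \<in> rel_ideal \<alpha> \<nu>"
    using fA_id_cong by (rule rel_ideal_add)
  then have "fA ?h * fA g - 1 \<in> rel_ideal \<alpha> \<nu>"
    by simp
  \<comment> \<open>The conjugation relation times fA g, up to the replacement of the product of fA ?h and fA g by 1.\<close>
  then have "fA g * fTheta i * (fA ?h * fA g - 1) - (fA g * fTheta i * fA ?h - fTheta (g i)) * fA g \<in> rel_ideal \<alpha> \<nu>"
    using conj g i
    by (intro rel_ideal_diff[OF rel_ideal_mult_left rel_ideal_mult_right] free_carrier_mult
        free_carrier_fA free_carrier_fTheta)
  then show ?thesis
    by (simp add: algebra_simps)
qed

lemma transpose_permutes_Om: "i \<in> Om \<alpha> \<Longrightarrow> j \<in> Om \<alpha> \<Longrightarrow> Transposition.transpose i j permutes Om \<alpha>"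
  by (rule permutes_swap_id)

text \<open>
  The last relation with the unit of the free algebra in place of \<open>A(1)\<close>. The expression in the proof is the relation plus
  the terms in which \<open>fA id - 1\<close> replaces one occurrence of \<open>fA id\<close>.
\<close>

lemma fA_transpose_cong:
  assumes "i \<in> Om \<alpha>" "j \<in> Om \<alpha>" "i \<noteq> j"
  shows "(fA (Transposition.transpose i j) - 1) * fTheta j * (fTheta i + 1) \<in> rel_ideal \<alpha> \<nu>"
proof -
  let ?a = "fA (Transposition.transpose i j)" and ?e = "fA id :: gen word \<Rightarrow>\<^sub>0 complex"
  have rel: "(?a - ?e) * fTheta j * (fTheta i + ?e) \<in> rel_ideal \<alpha> \<nu>"
    by (rule rels_rel_ideal) (use assms in \<open>unfold rels_def, blast\<close>)
  have "(?a - ?e) * fTheta j * (fTheta i + ?e) + (?e - 1) * (fTheta j * (fTheta i + ?e))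
      - (?a - 1) * fTheta j * (?e - 1) \<in> rel_ideal \<alpha> \<nu>"
    using assms
    by (intro rel_ideal_diff[OF rel_ideal_add[OF rel rel_ideal_mult_right[OF fA_id_cong]]
          rel_ideal_mult_left[OF fA_id_cong]] free_carrier_mult
        free_carrier_add free_carrier_diff free_carrier_1 free_carrier_fA free_carrier_fTheta
        transpose_permutes_Om permutes_id)
  then show ?thesis
    by (simp add: algebra_simps)
qed

section \<open>Standard monomials span the algebra of generators and relations\<close>

definition Th :: "nat list \<Rightarrow> (gen word \<Rightarrow>\<^sub>0 complex)" where
  "Th w = prod_list (map fTheta w)"

lemma Th_simps [simp]: "Th [] = 1" "Th (i # w) = fTheta i * Th w" "Th (u @ v) = Th u * Th v"
  by (simp_all add: Th_def)

lemma Th_carrier: "set w \<subseteq> Om \<alpha> \<Longrightarrow> Th w \<in> Fr \<alpha>"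
  by (induction w) (auto intro!: free_carrier_mult free_carrier_fTheta)

text \<open>
  The elements that are, modulo the relations, combinations of monomials with fewer than \<open>k\<close> factors \<open>\<Theta>\<close>. The strict
  inequality makes \<open>deg_less \<alpha> \<nu> 0\<close> the ideal itself and lets an error term of lower degree than a word \<open>w\<close> be an element of
  \<open>deg_less \<alpha> \<nu> (length w)\<close>, also if \<open>w\<close> is empty.
\<close>

inductive_set deg_less :: "nat \<Rightarrow> complex \<Rightarrow> nat \<Rightarrow> (gen word \<Rightarrow>\<^sub>0 complex) set"
  for \<alpha> \<nu> k where
  ideal: "p \<in> rel_ideal \<alpha> \<nu> \<Longrightarrow> p \<in> deg_less \<alpha> \<nu> k"
| monomial: "g permutes Om \<alpha> \<Longrightarrow> set w \<subseteq> Om \<alpha> \<Longrightarrow> length w < k \<Longrightarrow> fA g * Th w \<in> deg_less \<alpha> \<nu> k"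
| add: "p \<in> deg_less \<alpha> \<nu> k \<Longrightarrow> q \<in> deg_less \<alpha> \<nu> k \<Longrightarrow> p + q \<in> deg_less \<alpha> \<nu> k"
| scal: "p \<in> deg_less \<alpha> \<nu> k \<Longrightarrow> scal c p \<in> deg_less \<alpha> \<nu> k"

lemma deg_less_0: "0 \<in> deg_less \<alpha> \<nu> k"
  by (rule deg_less.ideal) (rule rel_ideal_0)

lemma deg_less_diff: "p \<in> deg_less \<alpha> \<nu> k \<Longrightarrow> q \<in> deg_less \<alpha> \<nu> k \<Longrightarrow> p - q \<in> deg_less \<alpha> \<nu> k"
  using deg_less.add[of p \<alpha> \<nu> k "scal (- 1) q"] deg_less.scal[of q \<alpha> \<nu> k "- 1"] by (simp add: scal_minus_one)

lemma deg_less_mono: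
  assumes "p \<in> deg_less \<alpha> \<nu> k" "k \<le> l"
  shows "p \<in> deg_less \<alpha> \<nu> l"
  using assms by (induction rule: deg_less.induct) (auto intro: deg_less.intros)

lemma deg_less_fA:
  assumes "p \<in> deg_less \<alpha> \<nu> k" and h: "h permutes Om \<alpha>"
  shows "fA h * p \<in> deg_less \<alpha> \<nu> k"
  using assms(1)
proof (induction rule: deg_less.induct)
  case (monomial g w)
  have "(fA h * fA g - fA (h \<circ> g)) * Th w + fA (h \<circ> g) * Th w \<in> deg_less \<alpha> \<nu> k"
    using monomial h
    by (intro deg_less.add deg_less.ideal[OF rel_ideal_mult_right] deg_less.monomial fA_mult_cong
        Th_carrier permutes_compose)
  then show ?case
    by (simp add: algebra_simps)
qed (auto intro: deg_less.intros rel_ideal_mult_left free_carrier_fA h simp: distrib_left mult_scal_right)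

lemma deg_less_fTheta_left:
  assumes "p \<in> deg_less \<alpha> \<nu> k" and i: "i \<in> Om \<alpha>"
  shows "fTheta i * p \<in> deg_less \<alpha> \<nu> (Suc k)"
  using assms(1)
proof (induction rule: deg_less.induct)
  case (monomial g w)
  define j where "j = inv_into UNIV g i"
  have j: "j \<in> Om \<alpha>" "g j = i"
    using permutes_in_image[OF permutes_inv[OF monomial(1)]] permutes_inverses[OF monomial(1)] i
    by (simp_all add: j_def)
  have "(fTheta (g j) * fA g - fA g * fTheta j) * Th w + fA g * Th (j # w) \<in> deg_less \<alpha> \<nu> (Suc k)"
    using monomial j
    by (intro deg_less.add deg_less.ideal[OF rel_ideal_mult_right] deg_less.monomial fTheta_fA_cong Th_carrier)
      simp_all
  then show ?case
    by (simp add: j algebra_simps)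
qed (auto intro: deg_less.intros rel_ideal_mult_left free_carrier_fTheta i simp: distrib_left mult_scal_right)

lemma deg_less_fTheta_right:
  assumes "p \<in> deg_less \<alpha> \<nu> k" and i: "i \<in> Om \<alpha>"
  shows "p * fTheta i \<in> deg_less \<alpha> \<nu> (Suc k)"
  using assms(1)
proof (induction rule: deg_less.induct)
  case (monomial g w)
  then show ?case
    using deg_less.monomial[of g \<alpha> "w @ [i]" "Suc k" \<nu>] i by (simp add: mult.assoc)
qed (auto intro: deg_less.intros rel_ideal_mult_right free_carrier_fTheta i simp: distrib_right mult_scal_left)

lemma deg_less_Th_right:
  assumes "p \<in> deg_less \<alpha> \<nu> k" "set v \<subseteq> Om \<alpha>"
  shows "p * Th v \<in> deg_less \<alpha> \<nu> (k + length v)"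
  using assms
proof (induction v arbitrary: p k)
  case (Cons i v)
  then show ?case
    using Cons.IH[OF deg_less_fTheta_right[of p \<alpha> \<nu> k i]] by (simp add: mult.assoc)
qed simp

lemma Th_deg_less:
  assumes "set w \<subseteq> Om \<alpha>"
  shows "Th w \<in> deg_less \<alpha> \<nu> (Suc (length w))"
proof -
  have "fA id * Th w - (fA id - 1) * Th w \<in> deg_less \<alpha> \<nu> (Suc (length w))"
    using assms fA_id_cong
    by (intro deg_less_diff deg_less.monomial deg_less.ideal[OF rel_ideal_mult_right] Th_carrier permutes_id)
      simp_all
  then show ?thesis
    by (simp add: algebra_simps)
qed

text \<open>
  By the commutator relation, a commutator of two factors \<open>\<Theta>\<close> has only one such factor in each term.
\<close>

lemma fTheta_commute:
  assumes ij: "i \<in> Om \<alpha>" "j \<in> Om \<alpha>"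
  shows "fTheta j * fTheta i - fTheta i * fTheta j \<in> deg_less \<alpha> \<nu> 2"
proof (cases "i = j")
  case True
  then show ?thesis
    by (simp add: deg_less_0)
next
  case False
  let ?t = "Transposition.transpose i j"
  have "(fTheta j * fTheta i - fTheta i * fTheta j) - fA ?t * (fTheta j - fTheta i) \<in> rel_ideal \<alpha> \<nu>"
    by (rule rels_rel_ideal) (use ij False in \<open>unfold rels_def, blast\<close>)
  then have "((fTheta j * fTheta i - fTheta i * fTheta j) - fA ?t * (fTheta j - fTheta i))
      + (fA ?t * Th [j] - fA ?t * Th [i]) \<in> deg_less \<alpha> \<nu> 2"
    using ij
    by (intro deg_less.add deg_less_diff deg_less.monomial transpose_permutes_Om deg_less.ideal) simp_all
  then show ?thesis
    by (simp add: algebra_simps)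
qed

lemma Th_fTheta_commute:
  assumes "set w \<subseteq> Om \<alpha>" and i: "i \<in> Om \<alpha>"
  shows "Th w * fTheta i - fTheta i * Th w \<in> deg_less \<alpha> \<nu> (Suc (length w))"
  using assms(1)
proof (induction w)
  case Nil
  then show ?case
    by (simp add: deg_less_0)
next
  case (Cons a w)
  have "fTheta a * (Th w * fTheta i - fTheta i * Th w) \<in> deg_less \<alpha> \<nu> (Suc (Suc (length w)))"
    using Cons by (intro deg_less_fTheta_left) simp_all
  moreover have "(fTheta a * fTheta i - fTheta i * fTheta a) * Th w \<in> deg_less \<alpha> \<nu> (2 + length w)"
    using Cons i by (intro deg_less_Th_right fTheta_commute) simp_all
  ultimately have "fTheta a * (Th w * fTheta i - fTheta i * Th w) + (fTheta a * fTheta i - fTheta i * fTheta a) * Th w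
      \<in> deg_less \<alpha> \<nu> (Suc (Suc (length w)))"
    by (intro deg_less.add) simp_all
  then show ?case
    by (simp add: algebra_simps)
qed

text \<open>
  Induction on the words: the first letter of \<open>w\<close> is moved to the front of \<open>w'\<close> by commuting it with the letters before it.
\<close>

lemma Th_reorder:
  assumes "mset w = mset w'" "set w \<subseteq> Om \<alpha>"
  shows "Th w - Th w' \<in> deg_less \<alpha> \<nu> (length w)"
  using assms
proof (induction w arbitrary: w')
  case Nil
  then show ?case
    by (simp add: deg_less_0)
next
  case (Cons i w)
  have "i \<in> set w'"
    using Cons.prems(1) by (metis list.set_intros(1) set_mset_mset)
  then obtain u v where w': "w' = u @ i # v"
    by (meson split_list)
  have ms: "mset w = mset (u @ v)"
    using Cons.prems(1) by (simp add: w')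
  then have len: "length w = length u + length v" and sets: "set u \<subseteq> Om \<alpha>" "set v \<subseteq> Om \<alpha>"
    using mset_eq_length[OF ms] mset_eq_setD[OF ms] Cons.prems(2) by auto
  have i: "i \<in> Om \<alpha>"
    using Cons.prems by simp
  have "fTheta i * (Th w - Th (u @ v)) \<in> deg_less \<alpha> \<nu> (Suc (length w))"
    using Cons ms i by (intro deg_less_fTheta_left Cons.IH) simp_all
  moreover have "(Th u * fTheta i - fTheta i * Th u) * Th v \<in> deg_less \<alpha> \<nu> (Suc (length u) + length v)"
    by (intro deg_less_Th_right Th_fTheta_commute sets i)
  ultimately have "fTheta i * (Th w - Th (u @ v)) - (Th u * fTheta i - fTheta i * Th u) * Th v
      \<in> deg_less \<alpha> \<nu> (Suc (length w))"
    using len by (intro deg_less_diff) simp_all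
  then show ?case
    by (simp add: w' algebra_simps)
qed

text \<open>
  Two equal letters can be brought together, and the quadratic relation replaces their product by terms of lower degree.
\<close>

lemma Th_not_distinct:
  assumes "\<not> distinct w" "set w \<subseteq> Om \<alpha>"
  shows "Th w \<in> deg_less \<alpha> \<nu> (length w)"
proof -
  obtain xs ys zs i where w: "w = xs @ [i] @ ys @ [i] @ zs"
    using not_distinct_decomp[OF assms(1)] by blast
  let ?v = "xs @ ys @ zs"
  have i: "i \<in> Om \<alpha>" and v: "set ?v \<subseteq> Om \<alpha>"
    using assms(2) by (auto simp: w)
  have len: "length w = length ?v + 2"
    by (simp add: w)
  have "fTheta i * fTheta i - (scal (\<nu> - 1) (fTheta i) + scal \<nu> (fA id)) \<in> rel_ideal \<alpha> \<nu>"
    by (rule rels_rel_ideal) (use i in \<open>unfold rels_def, blast\<close>)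
  then have "(fTheta i * fTheta i - (scal (\<nu> - 1) (fTheta i) + scal \<nu> (fA id))) * Th ?v \<in> deg_less \<alpha> \<nu> (length w)"
    using v by (intro deg_less.ideal rel_ideal_mult_right Th_carrier)
  moreover have "scal (\<nu> - 1) (Th (i # ?v)) \<in> deg_less \<alpha> \<nu> (length w)"
    using Th_deg_less[of "i # ?v" \<alpha> \<nu>] i v len by (intro deg_less.scal) simp
  moreover have "scal \<nu> (fA id * Th ?v) \<in> deg_less \<alpha> \<nu> (length w)"
    using v len by (intro deg_less.scal deg_less.monomial permutes_id) simp_all
  moreover have "Th w - Th (i # i # ?v) \<in> deg_less \<alpha> \<nu> (length w)"
    using assms(2) by (intro Th_reorder) (simp_all add: w)
  ultimately have "(Th w - Th (i # i # ?v))
      + ((fTheta i * fTheta i - (scal (\<nu> - 1) (fTheta i) + scal \<nu> (fA id))) * Th ?v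
        + (scal (\<nu> - 1) (Th (i # ?v)) + scal \<nu> (fA id * Th ?v))) \<in> deg_less \<alpha> \<nu> (length w)"
    by (intro deg_less.add)
  then show ?thesis
    by (simp add: algebra_simps mult_scal_left)
qed

text \<open>
  Up to lower degree, \<open>i\<close> and \<open>j\<close> are the first two letters, and the last relation says that the transposition
  fixes \<open>\<Theta>\<^sub>j \<Theta>\<^sub>i + \<Theta>\<^sub>j\<close>.
\<close>

lemma fA_transpose_Th:
  assumes ij: "i \<in> set w" "j \<in> set w" "i \<noteq> j" and w: "set w \<subseteq> Om \<alpha>"
  shows "fA (Transposition.transpose i j) * Th w - Th w \<in> deg_less \<alpha> \<nu> (length w)"
proof -
  let ?t = "Transposition.transpose i j"
  define v where "v = remove1 i (remove1 j w)"
  have rem: "mset xs = add_mset x (mset (remove1 x xs))" if "x \<in> set xs" for x and xs :: "nat list"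
    using that by simp
  have "mset w = add_mset j (mset (remove1 j w))" "mset (remove1 j w) = add_mset i (mset v)"
    unfolding v_def using ij by (intro rem; simp)+
  then have ms: "mset w = mset (j # i # v)"
    by simp
  have Om: "i \<in> Om \<alpha>" "j \<in> Om \<alpha>" "set v \<subseteq> Om \<alpha>"
    using ij w mset_eq_setD[OF ms] by auto
  have t: "?t permutes Om \<alpha>"
    using Om by (intro transpose_permutes_Om)
  have len: "length w = length v + 2"
    using mset_eq_length[OF ms] by simp
  have d: "Th w - Th (j # i # v) \<in> deg_less \<alpha> \<nu> (length w)"
    using ms w by (rule Th_reorder)
  have rel: "(fA ?t - 1) * fTheta j * (fTheta i + 1) * Th v \<in> deg_less \<alpha> \<nu> (length w)"
    using Om by (intro deg_less.ideal rel_ideal_mult_right[OF fA_transpose_cong] Th_carrier ij(3))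
  have low: "Th (j # v) \<in> deg_less \<alpha> \<nu> (length w)"
    using Th_deg_less[of "j # v" \<alpha> \<nu>] Om len by simp
  have alow: "fA ?t * Th (j # v) \<in> deg_less \<alpha> \<nu> (length w)"
    using Om len t by (intro deg_less.monomial) simp_all
  have ad: "fA ?t * (Th w - Th (j # i # v)) \<in> deg_less \<alpha> \<nu> (length w)"
    using d t by (rule deg_less_fA)
  have "(fA ?t * (Th w - Th (j # i # v)) - (Th w - Th (j # i # v)))
      + ((fA ?t - 1) * fTheta j * (fTheta i + 1) * Th v - (fA ?t * Th (j # v) - Th (j # v))) \<in> deg_less \<alpha> \<nu> (length w)"
    by (rule deg_less.add[OF deg_less_diff[OF ad d] deg_less_diff[OF rel deg_less_diff[OF alow low]]])
  then show ?thesis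
    by (simp add: algebra_simps)
qed

lemma fA_Th_absorb:
  assumes "h permutes set w" and w: "set w \<subseteq> Om \<alpha>"
  shows "fA h * Th w - Th w \<in> deg_less \<alpha> \<nu> (length w)"
  using assms(1) finite_set
proof (induction rule: permutes_induct)
  case id
  have "(fA id - 1) * Th w \<in> deg_less \<alpha> \<nu> (length w)"
    using w fA_id_cong by (intro deg_less.ideal rel_ideal_mult_right Th_carrier)
  then show ?case
    by (simp add: algebra_simps id_def)
next
  case (swap i j p)
  let ?t = "Transposition.transpose i j"
  have t: "?t permutes Om \<alpha>" and p: "p permutes Om \<alpha>"
    using swap w by (auto intro: transpose_permutes_Om permutes_subset)
  have "fA ?t * (fA p * Th w - Th w) + (fA ?t * Th w - Th w) - (fA ?t * fA p - fA (?t \<circ> p)) * Th w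
      \<in> deg_less \<alpha> \<nu> (length w)"
    using swap w t p
    by (intro deg_less_diff[OF deg_less.add[OF deg_less_fA fA_transpose_Th]
          deg_less.ideal[OF rel_ideal_mult_right[OF fA_mult_cong]]] Th_carrier)
  then show ?case
    by (simp add: algebra_simps o_def)
qed

definition perm_ext :: "nat \<Rightarrow> pbij \<Rightarrow> (nat \<Rightarrow> nat)" where
  "perm_ext \<alpha> \<sigma> = (SOME g. g permutes Om \<alpha> \<and> \<sigma> \<subseteq>\<^sub>m perm_pb \<alpha> g)"

text \<open>
  The complements of the domain and of the range have the same size, so a partial bijection extends to a permutation.
\<close>

lemma perm_ext:
  assumes "\<sigma> \<in> PB \<alpha>"
  shows "perm_ext \<alpha> \<sigma> permutes Om \<alpha>" "\<sigma> \<subseteq>\<^sub>m perm_pb \<alpha> (perm_ext \<alpha> \<sigma>)"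
proof -
  have sub: "dom \<sigma> \<subseteq> Om \<alpha>" "ran \<sigma> \<subseteq> Om \<alpha>"
    using assms by (auto simp: PB_def)
  have "card (Om \<alpha> - dom \<sigma>) = card (Om \<alpha> - ran \<sigma>)"
    using sub card_ran_eq_rk[OF assms] finite_dom_PB[OF assms] finite_ran_PB[OF assms]
    by (simp add: card_Diff_subset rk_def)
  then obtain f where f: "bij_betw f (Om \<alpha> - dom \<sigma>) (Om \<alpha> - ran \<sigma>)"
    using finite_same_card_bij[of "Om \<alpha> - dom \<sigma>" "Om \<alpha> - ran \<sigma>"] by auto
  define g where "g k = (if k \<in> dom \<sigma> then the (\<sigma> k) else if k \<in> Om \<alpha> then f k else k)" for k
  have "bij_betw g (dom \<sigma>) (ran \<sigma>)"
    unfolding bij_betw_def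
  proof
    show "inj_on g (dom \<sigma>)"
      using PB_injD[OF assms] by (auto simp: inj_on_def g_def)
    show "g ` dom \<sigma> = ran \<sigma>"
      by (force simp: g_def ran_def image_iff)
  qed
  moreover have "bij_betw g (Om \<alpha> - dom \<sigma>) (Om \<alpha> - ran \<sigma>)"
    using f by (subst bij_betw_cong[of _ g f]) (auto simp: g_def)
  ultimately have "bij_betw g (dom \<sigma> \<union> (Om \<alpha> - dom \<sigma>)) (ran \<sigma> \<union> (Om \<alpha> - ran \<sigma>))"
    by (rule bij_betw_combine) blast
  then have "bij_betw g (Om \<alpha>) (Om \<alpha>)"
    using sub by (simp add: Un_absorb1)
  moreover have "g k = k" if "k \<notin> Om \<alpha>" for k
    using that sub by (auto simp: g_def)
  ultimately have "g permutes Om \<alpha>"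
    by (rule bij_imp_permutes)
  moreover have "\<sigma> \<subseteq>\<^sub>m perm_pb \<alpha> g"
    using sub by (auto simp: map_le_def perm_pb_def restrict_map_def g_def)
  ultimately have "\<exists>g. g permutes Om \<alpha> \<and> \<sigma> \<subseteq>\<^sub>m perm_pb \<alpha> g"
    by blast
  from someI_ex[OF this] show "perm_ext \<alpha> \<sigma> permutes Om \<alpha>" "\<sigma> \<subseteq>\<^sub>m perm_pb \<alpha> (perm_ext \<alpha> \<sigma>)"
    by (simp_all add: perm_ext_def)
qed

text \<open>
  The choices of the extension and of the order of the factors only matter up to terms of lower degree.
\<close>

definition std_monomial :: "nat \<Rightarrow> pbij \<Rightarrow> (gen word \<Rightarrow>\<^sub>0 complex)" where
  "std_monomial \<alpha> \<sigma> = fA (perm_ext \<alpha> \<sigma>) * Th (sorted_list_of_set (Om \<alpha> - dom \<sigma>))"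

lemma std_monomial_carrier: "\<sigma> \<in> PB \<alpha> \<Longrightarrow> std_monomial \<alpha> \<sigma> \<in> Fr \<alpha>"
  unfolding std_monomial_def by (intro free_carrier_mult free_carrier_fA perm_ext Th_carrier) auto

text \<open>
  Let \<open>\<sigma>\<close> be the restriction of \<open>g\<close> to the complement of \<open>set w\<close>. The permutation chosen for \<open>\<sigma>\<close> differs from \<open>g\<close>
  by a factor \<open>h\<close> on the right that only moves letters of \<open>w\<close>. This factor is absorbed by \<open>Th w\<close>, and then the letters are sorted.
\<close>

lemma monomial_reduce:
  assumes g: "g permutes Om \<alpha>" and w: "set w \<subseteq> Om \<alpha>" "distinct w"
  obtains \<sigma> where "\<sigma> \<in> PB \<alpha>" "fA g * Th w - std_monomial \<alpha> \<sigma> \<in> deg_less \<alpha> \<nu> (length w)"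
proof -
  define \<sigma> where "\<sigma> = perm_pb \<alpha> g |` (Om \<alpha> - set w)"
  have \<sigma>_iff: "\<sigma> k = Some i \<longleftrightarrow> k \<in> Om \<alpha> - set w \<and> g k = i" for k i
    by (auto simp: \<sigma>_def restrict_map_def perm_pb_iff)
  have \<sigma>: "\<sigma> \<in> PB \<alpha>"
    by (rule PB_I) (auto simp: \<sigma>_iff permutes_in_image[OF g] inj_eq[OF permutes_inj[OF g]])
  let ?g = "perm_ext \<alpha> \<sigma>" and ?s = "sorted_list_of_set (Om \<alpha> - dom \<sigma>)"
  note g' = perm_ext(1)[OF \<sigma>]
  have agree: "?g k = g k" if "k \<in> Om \<alpha> - set w" for k
    using map_le_SomeD[OF perm_ext(2)[OF \<sigma>], of k "g k"] that by (simp add: \<sigma>_iff perm_pb_iff)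
  have "Om \<alpha> - dom \<sigma> = set w"
    using w by (auto simp: \<sigma>_iff dom_def)
  then have s: "mset w = mset ?s"
    using w by (simp add: set_eq_iff_mset_eq_distinct[symmetric])
  define h where "h = inv_into UNIV ?g \<circ> g"
  have hOm: "h permutes Om \<alpha>"
    unfolding h_def by (intro permutes_compose g permutes_inv g')
  have gh: "?g \<circ> h = g"
    by (auto simp: h_def permutes_inverses[OF g'])
  have "h permutes set w"
  proof (rule permutes_superset[OF hOm])
    fix k assume "k \<in> Om \<alpha> - set w"
    then show "h k = k"
      using agree[of k] by (simp add: h_def permutes_inverses[OF g'] flip: agree)
  qed
  then have "fA ?g * (fA h * Th w - Th w) \<in> deg_less \<alpha> \<nu> (length w)"
    using w g' by (intro deg_less_fA fA_Th_absorb)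
  moreover have "fA ?g * (Th w - Th ?s) \<in> deg_less \<alpha> \<nu> (length w)"
    using w g' s by (intro deg_less_fA Th_reorder)
  moreover have "(fA ?g * fA h - fA g) * Th w \<in> deg_less \<alpha> \<nu> (length w)"
    using fA_mult_cong[OF g' hOm, of \<nu>] w unfolding gh
    by (intro deg_less.ideal rel_ideal_mult_right Th_carrier)
  ultimately have "fA ?g * (fA h * Th w - Th w) + fA ?g * (Th w - Th ?s) - (fA ?g * fA h - fA g) * Th w
      \<in> deg_less \<alpha> \<nu> (length w)"
    by (intro deg_less.add deg_less_diff)
  then have "fA g * Th w - std_monomial \<alpha> \<sigma> \<in> deg_less \<alpha> \<nu> (length w)"
    by (simp add: std_monomial_def algebra_simps)
  with \<sigma> that show ?thesis
    by blast
qed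

definition std_span :: "nat \<Rightarrow> complex \<Rightarrow> (gen word \<Rightarrow>\<^sub>0 complex) set" where
  "std_span \<alpha> \<nu> = {p. \<exists>c. p - (\<Sum>\<sigma>\<in>PB \<alpha>. scal (c \<sigma>) (std_monomial \<alpha> \<sigma>)) \<in> rel_ideal \<alpha> \<nu>}"

lemma std_span_ideal: "p \<in> rel_ideal \<alpha> \<nu> \<Longrightarrow> p \<in> std_span \<alpha> \<nu>"
  unfolding std_span_def by (intro CollectI exI[of _ "\<lambda>_. 0"]) simp

lemma std_span_monomial:
  assumes "\<sigma> \<in> PB \<alpha>"
  shows "std_monomial \<alpha> \<sigma> \<in> std_span \<alpha> \<nu>"
proof -
  have "(\<Sum>\<tau>\<in>PB \<alpha>. scal (of_bool (\<tau> = \<sigma>)) (std_monomial \<alpha> \<tau>)) = (\<Sum>\<tau>\<in>PB \<alpha>. if \<tau> = \<sigma> then std_monomial \<alpha> \<sigma> else 0)"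
    by (intro sum.cong refl) auto
  also have "\<dots> = std_monomial \<alpha> \<sigma>"
    using assms by simp
  finally show ?thesis
    unfolding std_span_def by (intro CollectI exI[of _ "\<lambda>\<tau>. of_bool (\<tau> = \<sigma>)"]) (simp add: rel_ideal_0)
qed

lemma std_span_add:
  assumes "p \<in> std_span \<alpha> \<nu>" "q \<in> std_span \<alpha> \<nu>"
  shows "p + q \<in> std_span \<alpha> \<nu>"
proof -
  let ?S = "\<lambda>c. \<Sum>\<sigma>\<in>PB \<alpha>. scal (c \<sigma>) (std_monomial \<alpha> \<sigma>)"
  obtain c d where "p - ?S c \<in> rel_ideal \<alpha> \<nu>" "q - ?S d \<in> rel_ideal \<alpha> \<nu>"
    using assms by (auto simp: std_span_def)
  then have "(p - ?S c) + (q - ?S d) \<in> rel_ideal \<alpha> \<nu>"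
    by (rule rel_ideal_add)
  then have "(p + q) - ?S (\<lambda>\<sigma>. c \<sigma> + d \<sigma>) \<in> rel_ideal \<alpha> \<nu>"
    by (simp add: scal_add_left sum.distrib algebra_simps)
  then show ?thesis
    unfolding std_span_def by (intro CollectI exI[of _ "\<lambda>\<sigma>. c \<sigma> + d \<sigma>"])
qed

lemma std_span_scal:
  assumes "p \<in> std_span \<alpha> \<nu>"
  shows "scal a p \<in> std_span \<alpha> \<nu>"
proof -
  let ?S = "\<lambda>c. \<Sum>\<sigma>\<in>PB \<alpha>. scal (c \<sigma>) (std_monomial \<alpha> \<sigma>)"
  obtain c where "p - ?S c \<in> rel_ideal \<alpha> \<nu>"
    using assms by (auto simp: std_span_def)
  then have "scal a (p - ?S c) \<in> rel_ideal \<alpha> \<nu>"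
    by (rule rel_ideal_scal)
  then have "scal a p - ?S (\<lambda>\<sigma>. a * c \<sigma>) \<in> rel_ideal \<alpha> \<nu>"
    by (simp add: scal_diff scal_sum scal_scal)
  then show ?thesis
    unfolding std_span_def by (intro CollectI exI[of _ "\<lambda>\<sigma>. a * c \<sigma>"])
qed

text \<open>
  A monomial agrees with a standard monomial, or vanishes if a letter is repeated, up to an error of lower degree, which the
  induction hypothesis covers.
\<close>

lemma deg_less_std_span: "p \<in> deg_less \<alpha> \<nu> k \<Longrightarrow> p \<in> std_span \<alpha> \<nu>"
proof (induction k arbitrary: p)
  case 0
  then show ?case
    by (induction rule: deg_less.induct) (auto intro: std_span_ideal std_span_add std_span_scal)
next
  case (Suc k)
  have lower: "q \<in> std_span \<alpha> \<nu>" if "q \<in> deg_less \<alpha> \<nu> l" "l < Suc k" for q l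
    using Suc.IH[OF deg_less_mono[OF that(1), of k]] that(2) by simp
  show ?case
    using Suc.prems
  proof (induction rule: deg_less.induct)
    case (monomial g w)
    show ?case
    proof (cases "distinct w")
      case True
      then obtain \<sigma> where "\<sigma> \<in> PB \<alpha>" "fA g * Th w - std_monomial \<alpha> \<sigma> \<in> deg_less \<alpha> \<nu> (length w)"
        using monomial_reduce[OF monomial(1,2)] by blast
      then have "(fA g * Th w - std_monomial \<alpha> \<sigma>) + std_monomial \<alpha> \<sigma> \<in> std_span \<alpha> \<nu>"
        using monomial(3) by (intro std_span_add std_span_monomial lower)
      then show ?thesis
        by simp
    next
      case False
      then show ?thesis
        using monomial by (intro lower[OF deg_less_fA[OF Th_not_distinct]])
    qed
  qed (auto intro: std_span_ideal std_span_add std_span_scal)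
qed

lemma single_word_Cons:
  "Poly_Mapping.single (Word (x # xs)) (1 :: complex) = free_gen x * Poly_Mapping.single (Word xs) 1"
  by (simp add: free_gen_def mult_single plus_word_def)

lemma single_word_deg_less:
  "set xs \<subseteq> gens \<alpha> \<Longrightarrow> \<exists>k. Poly_Mapping.single (Word xs) 1 \<in> deg_less \<alpha> \<nu> k"
proof (induction xs)
  case Nil
  have "Poly_Mapping.single (Word []) 1 = (1 :: gen word \<Rightarrow>\<^sub>0 complex)"
    by (simp flip: zero_word_def)
  then show ?case
    using Th_deg_less[of "[]" \<alpha> \<nu>] by auto
next
  case (Cons x xs)
  then obtain k where k: "Poly_Mapping.single (Word xs) 1 \<in> deg_less \<alpha> \<nu> k"
    by auto
  have "free_gen x * Poly_Mapping.single (Word xs) 1 \<in> deg_less \<alpha> \<nu> (Suc k)"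
  proof (cases x)
    case (Gen_A g)
    then show ?thesis
      using Cons.prems deg_less_mono[OF deg_less_fA[OF k]] by simp
  next
    case (Gen_Theta i)
    then show ?thesis
      using Cons.prems deg_less_fTheta_left[OF k] by simp
  qed
  then show ?case
    unfolding single_word_Cons by blast
qed

lemma free_carrier_std_span:
  assumes "p \<in> Fr \<alpha>"
  shows "p \<in> std_span \<alpha> \<nu>"
proof -
  have zero: "0 \<in> std_span \<alpha> \<nu>"
    by (intro std_span_ideal rel_ideal_0)
  have word: "Poly_Mapping.single w c \<in> std_span \<alpha> \<nu>" if w: "set (letters w) \<subseteq> gens \<alpha>" for w c
  proof -
    obtain k where "Poly_Mapping.single (Word (letters w)) 1 \<in> deg_less \<alpha> \<nu> k"
      using single_word_deg_less[OF w] by blast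
    then have "scal c (Poly_Mapping.single w 1) \<in> std_span \<alpha> \<nu>"
      using deg_less_std_span by (intro std_span_scal) simp
    then show ?thesis
      by (simp add: scal_single)
  qed
  have sums: "(\<Sum>w\<in>K. Poly_Mapping.single w (f w)) \<in> std_span \<alpha> \<nu>"
    if "finite K" "\<forall>w\<in>K. set (letters w) \<subseteq> gens \<alpha>" for K f
    using that by (induction K rule: finite_induct) (auto intro!: zero std_span_add word)
  have "(\<Sum>w\<in>Poly_Mapping.keys p. Poly_Mapping.single w (Poly_Mapping.lookup p w)) \<in> std_span \<alpha> \<nu>"
    using assms by (intro sums) (simp_all add: free_carrier_def)
  then show ?thesis
    by (simp only: sum_single_keys[OF finite_keys order_refl, symmetric])
qed

section \<open>Standard monomials have triangular images\<close>

lemma rk_mono: "f \<subseteq>\<^sub>m \<kappa> \<Longrightarrow> \<kappa> \<in> PB \<alpha> \<Longrightarrow> rk f \<le> rk \<kappa>"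
  unfolding rk_def by (intro card_mono finite_dom_PB map_le_implies_dom_le)

lemma rk_strict_mono:
  assumes "f \<subseteq>\<^sub>m \<kappa>" "\<kappa> \<in> PB \<alpha>" "\<kappa> \<noteq> f"
  shows "rk f < rk \<kappa>"
proof -
  have "dom f \<subset> dom \<kappa>"
    using map_le_dom_eq[OF assms(1)] map_le_implies_dom_le[OF assms(1)] assms(3) by blast
  then show ?thesis
    unfolding rk_def using finite_dom_PB[OF assms(2)] by (rule psubset_card_mono[rotated])
qed

definition rk_ge :: "nat \<Rightarrow> nat \<Rightarrow> (pbij \<Rightarrow>\<^sub>0 complex) set" where
  "rk_ge \<alpha> r = {p \<in> O_carrier \<alpha>. \<forall>\<kappa>. Poly_Mapping.lookup p \<kappa> \<noteq> 0 \<longrightarrow> r \<le> rk \<kappa>}"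

lemma rk_ge_carrier: "p \<in> rk_ge \<alpha> r \<Longrightarrow> p \<in> O_carrier \<alpha>"
  by (simp add: rk_ge_def)

lemma rk_ge_add: "p \<in> rk_ge \<alpha> r \<Longrightarrow> q \<in> rk_ge \<alpha> r \<Longrightarrow> p + q \<in> rk_ge \<alpha> r"
  by (auto simp: rk_ge_def lookup_add) (metis add_0)

lemma lookup_O_mult_Xi:
  assumes "\<sigma> \<in> PB \<alpha>" "\<tau> \<in> PB \<alpha>" "\<kappa> \<in> PB \<alpha>"
  shows "Poly_Mapping.lookup (O_mult \<alpha> \<nu> (Xi \<sigma>) (Xi \<tau>)) \<kappa> = struct_const \<alpha> \<nu> \<kappa> \<sigma> \<tau>"
  using assms by (simp add: O_mult_Xi lookup_sum_Xi)

lemma lookup_O_mult_left: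
  assumes "\<sigma> \<in> PB \<alpha>" "q \<in> O_carrier \<alpha>"
  shows "Poly_Mapping.lookup (O_mult \<alpha> \<nu> (Xi \<sigma>) q) \<kappa> =
    (if \<kappa> \<in> PB \<alpha> then \<Sum>\<tau>\<in>PB \<alpha>. Poly_Mapping.lookup q \<tau> * struct_const \<alpha> \<nu> \<kappa> \<sigma> \<tau> else 0)"
proof -
  have "(\<Sum>\<rho>\<in>PB \<alpha>. \<Sum>\<tau>\<in>PB \<alpha>. of_bool (\<sigma> = \<rho>) * Poly_Mapping.lookup q \<tau> * struct_const \<alpha> \<nu> \<kappa> \<rho> \<tau>)
     = (\<Sum>\<rho>\<in>PB \<alpha>. if \<sigma> = \<rho> then \<Sum>\<tau>\<in>PB \<alpha>. Poly_Mapping.lookup q \<tau> * struct_const \<alpha> \<nu> \<kappa> \<sigma> \<tau> else 0)"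
    by (intro sum.cong refl) auto
  also have "\<dots> = (\<Sum>\<tau>\<in>PB \<alpha>. Poly_Mapping.lookup q \<tau> * struct_const \<alpha> \<nu> \<kappa> \<sigma> \<tau>)"
    using assms by simp
  finally show ?thesis
    using assms by (simp add: lookup_O_mult[OF O_carrier_Xi assms(2)] lookup_Xi)
qed

text \<open>
  A basis element \<open>Xi \<kappa>\<close> that occurs in \<open>Xi \<sigma> * Xi \<tau>\<close> extends \<open>\<sigma> \<circ>\<^sub>m \<tau>\<close>, and \<open>rk (\<sigma> \<circ>\<^sub>m \<tau>) \<ge> rk \<sigma> + rk \<tau> - \<alpha>\<close>.
  Truncation of the difference at zero is harmless in a lower bound.
\<close>

lemma O_mult_rk_ge:
  assumes \<sigma>: "\<sigma> \<in> PB \<alpha>" and q: "q \<in> rk_ge \<alpha> r"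
  shows "O_mult \<alpha> \<nu> (Xi \<sigma>) q \<in> rk_ge \<alpha> (r + rk \<sigma> - \<alpha>)"
proof -
  have "r + rk \<sigma> - \<alpha> \<le> rk \<kappa>" if nz: "Poly_Mapping.lookup (O_mult \<alpha> \<nu> (Xi \<sigma>) q) \<kappa> \<noteq> 0" for \<kappa>
  proof -
    from nz have \<kappa>: "\<kappa> \<in> PB \<alpha>"
      and "(\<Sum>\<tau>\<in>PB \<alpha>. Poly_Mapping.lookup q \<tau> * struct_const \<alpha> \<nu> \<kappa> \<sigma> \<tau>) \<noteq> 0"
      unfolding lookup_O_mult_left[OF \<sigma> rk_ge_carrier[OF q]] by (auto split: if_splits)
    then obtain \<tau> where "\<tau> \<in> PB \<alpha>" "Poly_Mapping.lookup q \<tau> * struct_const \<alpha> \<nu> \<kappa> \<sigma> \<tau> \<noteq> 0"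
      by (elim sum.not_neutral_contains_not_neutral)
    then have \<tau>: "\<tau> \<in> PB \<alpha>" "Poly_Mapping.lookup q \<tau> \<noteq> 0" "struct_const \<alpha> \<nu> \<kappa> \<sigma> \<tau> \<noteq> 0"
      by simp_all
    have "\<sigma> \<circ>\<^sub>m \<tau> \<subseteq>\<^sub>m \<kappa>"
      using \<tau>(3) by (auto simp: struct_const_def split: if_splits)
    then have "rk (\<sigma> \<circ>\<^sub>m \<tau>) \<le> rk \<kappa>"
      using \<kappa> by (rule rk_mono)
    moreover have "card (dom \<sigma> \<union> ran \<tau>) \<le> \<alpha>"
      using \<sigma> \<tau>(1) card_mono[OF finite_Om, of "dom \<sigma> \<union> ran \<tau>" \<alpha>] by (simp add: PB_def)
    moreover have "r \<le> rk \<tau>"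
      using q \<tau>(2) by (simp add: rk_ge_def)
    ultimately show ?thesis
      using card_dom_Un_ran[OF \<sigma> \<tau>(1)] by linarith
  qed
  then show ?thesis
    using \<sigma> rk_ge_carrier[OF q] by (simp add: rk_ge_def O_carrier_mult O_carrier_Xi)
qed

text \<open>
  For \<open>i\<close> outside \<open>J\<close> the structure constants are 0 or 1. The composition of the two factors occurs, and all other terms
  properly extend it and thus have larger rank.
\<close>

lemma theta_Xi_id_off:
  assumes i: "i \<in> Om \<alpha> - J" and J: "J \<subseteq> Om \<alpha>"
  shows "O_mult \<alpha> \<nu> (theta \<alpha> i) (Xi (id_off \<alpha> J)) - Xi (id_off \<alpha> (insert i J)) \<in> rk_ge \<alpha> (Suc (\<alpha> - card (insert i J)))"
    (is "?x \<in> _")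
proof -
  have PB: "T \<alpha> i \<in> PB \<alpha>" "id_off \<alpha> J \<in> PB \<alpha>" "id_off \<alpha> (insert i J) \<in> PB \<alpha>"
    by (simp_all add: T_eq_id_off id_off_PB)
  have full: "dom (T \<alpha> i) \<union> ran (id_off \<alpha> J) = Om \<alpha>"
    using i J by (auto simp: T_eq_id_off dom_id_off ran_id_off)
  have comp: "T \<alpha> i \<circ>\<^sub>m id_off \<alpha> J = id_off \<alpha> (insert i J)"
    using id_off_comp[of \<alpha> "{i}" J] by (simp add: T_eq_id_off)
  have rk: "rk (id_off \<alpha> (insert i J)) = \<alpha> - card (insert i J)"
    using i J by (intro rk_id_off) simp
  have carrier: "?x \<in> O_carrier \<alpha>"
    using PB by (intro O_carrier_diff O_carrier_mult theta_carrier O_carrier_Xi)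
  moreover have "Suc (\<alpha> - card (insert i J)) \<le> rk \<kappa>" if nz: "Poly_Mapping.lookup ?x \<kappa> \<noteq> 0" for \<kappa>
  proof -
    have \<kappa>: "\<kappa> \<in> PB \<alpha>"
      using nz carrier by (auto simp: O_carrier_iff)
    have "Poly_Mapping.lookup ?x \<kappa> = of_bool (admissible \<kappa> (T \<alpha> i) (id_off \<alpha> J)) - of_bool (id_off \<alpha> (insert i J) = \<kappa>)"
      using PB \<kappa> struct_const_full[OF PB(1,2) full]
      by (simp add: lookup_minus theta_def lookup_O_mult_Xi lookup_Xi)
    then have "admissible \<kappa> (T \<alpha> i) (id_off \<alpha> J)" "\<kappa> \<noteq> id_off \<alpha> (insert i J)"
      using nz admissible_comp[of "T \<alpha> i" "id_off \<alpha> J"] unfolding comp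
      by (cases "\<kappa> = id_off \<alpha> (insert i J)"; auto split: if_splits)+
    then show ?thesis
      using rk_strict_mono[of "id_off \<alpha> (insert i J)" \<kappa> \<alpha>] \<kappa> rk comp by (simp add: admissible_def)
  qed
  ultimately show ?thesis
    by (simp add: rk_ge_def)
qed

text \<open>
  Multiplication by \<open>\<theta>\<^sub>i\<close> lowers the rank of any term by at most one, so the error terms stay of larger rank than
  the leading term, whose rank drops by exactly one.
\<close>

lemma free_hom_Th:
  assumes "distinct w" "set w \<subseteq> Om \<alpha>"
  shows "free_hom \<alpha> \<nu> (Th w) - Xi (id_off \<alpha> (set w)) \<in> rk_ge \<alpha> (Suc (\<alpha> - length w))"
  using assms
proof (induction w)
  case Nil
  then show ?case
    by (simp add: free_hom_one perm_pb_id_eq rk_ge_def O_carrier_0)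
next
  case (Cons i w)
  have i: "i \<in> Om \<alpha> - set w" and w: "set w \<subseteq> Om \<alpha>" "distinct w"
    using Cons.prems by auto
  have len: "Suc (length w) \<le> \<alpha>"
    using card_mono[OF finite_Om Cons.prems(2)] distinct_card[OF Cons.prems(1)] by simp
  define q where "q = free_hom \<alpha> \<nu> (Th w) - Xi (id_off \<alpha> (set w))"
  have q: "q \<in> rk_ge \<alpha> (Suc (\<alpha> - length w))"
    unfolding q_def using Cons.IH w by simp
  have T: "T \<alpha> i \<in> PB \<alpha>" "rk (T \<alpha> i) = \<alpha> - 1"
    using i rk_id_off[of "{i}" \<alpha>] by (simp_all add: T_eq_id_off id_off_PB)
  have "O_mult \<alpha> \<nu> (theta \<alpha> i) q \<in> rk_ge \<alpha> (Suc (\<alpha> - length w) + (\<alpha> - 1) - \<alpha>)"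
    using O_mult_rk_ge[OF T(1) q] by (simp add: T(2) theta_def)
  also have "Suc (\<alpha> - length w) + (\<alpha> - 1) - \<alpha> = Suc (\<alpha> - length (i # w))"
    using len by simp
  finally have high: "O_mult \<alpha> \<nu> (theta \<alpha> i) q \<in> rk_ge \<alpha> (Suc (\<alpha> - length (i # w)))" .
  have "card (insert i (set w)) = length (i # w)"
    using distinct_card[OF Cons.prems(1)] by simp
  then have lead: "O_mult \<alpha> \<nu> (theta \<alpha> i) (Xi (id_off \<alpha> (set w))) - Xi (id_off \<alpha> (set (i # w)))
      \<in> rk_ge \<alpha> (Suc (\<alpha> - length (i # w)))"
    using theta_Xi_id_off[OF i w(1), of \<nu>] by simp
  have "free_hom \<alpha> \<nu> (Th (i # w)) = O_mult \<alpha> \<nu> (theta \<alpha> i) (free_hom \<alpha> \<nu> (Th w))"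
    using i w by (simp add: free_hom_mult free_carrier_fTheta Th_carrier free_hom_gen)
  also have "\<dots> = O_mult \<alpha> \<nu> (theta \<alpha> i) (Xi (id_off \<alpha> (set w)) + q)"
    by (simp add: q_def)
  also have "\<dots> = O_mult \<alpha> \<nu> (theta \<alpha> i) (Xi (id_off \<alpha> (set w))) + O_mult \<alpha> \<nu> (theta \<alpha> i) q"
    using rk_ge_carrier[OF q] by (intro O_mult_add_right theta_carrier O_carrier_Xi id_off_PB)
  finally show ?case
    using rk_ge_add[OF lead high] by (simp add: algebra_simps)
qed

lemma free_hom_std_monomial:
  assumes \<sigma>: "\<sigma> \<in> PB \<alpha>"
  shows "free_hom \<alpha> \<nu> (std_monomial \<alpha> \<sigma>) - Xi \<sigma> \<in> rk_ge \<alpha> (Suc (rk \<sigma>))"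
proof -
  let ?w = "sorted_list_of_set (Om \<alpha> - dom \<sigma>)" and ?g = "perm_pb \<alpha> (perm_ext \<alpha> \<sigma>)"
  note g = perm_ext[OF \<sigma>]
  have dom: "dom \<sigma> \<subseteq> Om \<alpha>"
    using \<sigma> by (simp add: PB_def)
  have w: "distinct ?w" "set ?w = Om \<alpha> - dom \<sigma>"
    by simp_all
  have "\<alpha> - length ?w = rk \<sigma>"
    using dom rk_le[OF \<sigma>] finite_dom_PB[OF \<sigma>] by (simp add: card_Diff_subset rk_def)
  then have q: "free_hom \<alpha> \<nu> (Th ?w) - Xi (id_off \<alpha> (set ?w)) \<in> rk_ge \<alpha> (Suc (rk \<sigma>))" (is "?q \<in> _")
    using free_hom_Th[of ?w \<alpha> \<nu>] w by simp
  have gPB: "?g \<in> PB \<alpha>" "rk ?g = \<alpha>"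
    using g by (simp_all add: perm_pb_PB rk_def dom_perm_pb)
  have "?g \<circ>\<^sub>m id_off \<alpha> (set ?w) = \<sigma>"
  proof -
    have "(?g \<circ>\<^sub>m id_off \<alpha> (set ?w)) k = Some i \<longleftrightarrow> \<sigma> k = Some i" for k i
      unfolding w(2) map_comp_Some_iff id_off_iff
      using dom g(2) by (cases "k \<in> dom \<sigma>") (auto simp: map_le_def)
    then show ?thesis
      by (simp add: map_eq_iff_Some)
  qed
  then have lead: "O_mult \<alpha> \<nu> (Xi ?g) (Xi (id_off \<alpha> (set ?w))) = Xi \<sigma>"
    by (simp add: O_mult_perm_left[OF g(1) id_off_PB])
  have "free_hom \<alpha> \<nu> (std_monomial \<alpha> \<sigma>) = O_mult \<alpha> \<nu> (Xi ?g) (free_hom \<alpha> \<nu> (Th ?w))"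
    using g(1) Th_carrier[of ?w \<alpha>] by (simp add: std_monomial_def free_hom_mult free_carrier_fA free_hom_gen)
  also have "\<dots> = O_mult \<alpha> \<nu> (Xi ?g) (Xi (id_off \<alpha> (set ?w)) + ?q)"
    by simp
  also have "\<dots> = Xi \<sigma> + O_mult \<alpha> \<nu> (Xi ?g) ?q"
    unfolding lead[symmetric] using rk_ge_carrier[OF q] gPB
    by (intro O_mult_add_right O_carrier_Xi id_off_PB)
  finally show ?thesis
    using O_mult_rk_ge[OF gPB(1) q, of \<nu>] gPB(2) by simp
qed

text \<open>
  Descending induction on the rank: \<open>Xi \<sigma>\<close> is the image of its standard monomial up to basis elements of larger rank.
\<close>

lemma Xi_in_image:
  assumes "\<sigma> \<in> PB \<alpha>"
  shows "Xi \<sigma> \<in> free_hom \<alpha> \<nu> ` Fr \<alpha>"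
  using assms
proof (induction "\<alpha> - rk \<sigma>" arbitrary: \<sigma> rule: less_induct)
  case less
  define q where "q = free_hom \<alpha> \<nu> (std_monomial \<alpha> \<sigma>) - Xi \<sigma>"
  have q: "q \<in> rk_ge \<alpha> (Suc (rk \<sigma>))"
    unfolding q_def using less.prems by (rule free_hom_std_monomial)
  have "\<exists>p\<in>Fr \<alpha>. free_hom \<alpha> \<nu> p = scal (Poly_Mapping.lookup q \<kappa>) (Xi \<kappa>)" if \<kappa>: "\<kappa> \<in> PB \<alpha>" for \<kappa>
  proof (cases "Poly_Mapping.lookup q \<kappa> = 0")
    case True
    then show ?thesis
      by (intro bexI[of _ 0]) (simp_all add: free_carrier_0)
  next
    case False
    then have "rk \<sigma> < rk \<kappa>"
      using q by (auto simp: rk_ge_def Suc_le_eq)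
    then have "\<alpha> - rk \<kappa> < \<alpha> - rk \<sigma>"
      using rk_le[OF \<kappa>] by simp
    then obtain p where "p \<in> Fr \<alpha>" "Xi \<kappa> = free_hom \<alpha> \<nu> p"
      using less.hyps \<kappa> by blast
    then show ?thesis
      by (intro bexI[of _ "scal (Poly_Mapping.lookup q \<kappa>) p"]) (simp_all add: free_hom_scal free_carrier_scal)
  qed
  then obtain P where P: "\<And>\<kappa>. \<kappa> \<in> PB \<alpha> \<Longrightarrow> P \<kappa> \<in> Fr \<alpha> \<and> free_hom \<alpha> \<nu> (P \<kappa>) = scal (Poly_Mapping.lookup q \<kappa>) (Xi \<kappa>)"
    by metis
  have "free_hom \<alpha> \<nu> (std_monomial \<alpha> \<sigma> - (\<Sum>\<kappa>\<in>PB \<alpha>. P \<kappa>)) = free_hom \<alpha> \<nu> (std_monomial \<alpha> \<sigma>) - q"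
    using P O_carrier_expand[OF rk_ge_carrier[OF q]] by (simp add: free_hom_diff free_hom_sum)
  also have "\<dots> = Xi \<sigma>"
    by (simp add: q_def)
  finally show ?case
    using P std_monomial_carrier[OF less.prems]
    by (intro image_eqI[of _ _ "std_monomial \<alpha> \<sigma> - (\<Sum>\<kappa>\<in>PB \<alpha>. P \<kappa>)"] free_carrier_diff free_carrier_sum) auto
qed

lemma free_hom_surj: "free_hom \<alpha> \<nu> ` Fr \<alpha> = O_carrier \<alpha>"
proof
  show "free_hom \<alpha> \<nu> ` Fr \<alpha> \<subseteq> O_carrier \<alpha>"
    using free_hom_carrier by blast
  show "O_carrier \<alpha> \<subseteq> free_hom \<alpha> \<nu> ` Fr \<alpha>"
  proof
    fix p assume p: "p \<in> O_carrier \<alpha>"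
    have "\<forall>\<kappa>\<in>PB \<alpha>. \<exists>q. q \<in> Fr \<alpha> \<and> Xi \<kappa> = free_hom \<alpha> \<nu> q"
      using Xi_in_image[of _ \<alpha> \<nu>] by (simp add: image_iff) blast
    from bchoice[OF this] obtain P
      where P: "\<forall>\<kappa>\<in>PB \<alpha>. P \<kappa> \<in> Fr \<alpha> \<and> Xi \<kappa> = free_hom \<alpha> \<nu> (P \<kappa>)"
      by blast
    have "p = (\<Sum>\<sigma>\<in>PB \<alpha>. scal (Poly_Mapping.lookup p \<sigma>) (Xi \<sigma>))"
      using p by (rule O_carrier_expand)
    also have "\<dots> = free_hom \<alpha> \<nu> (\<Sum>\<sigma>\<in>PB \<alpha>. scal (Poly_Mapping.lookup p \<sigma>) (P \<sigma>))"
      using P by (simp add: free_hom_sum free_hom_scal)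
    finally show "p \<in> free_hom \<alpha> \<nu> ` Fr \<alpha>"
      using P by (intro image_eqI free_carrier_sum free_carrier_scal) auto
  qed
qed

text \<open>
  Among the terms with nonzero coefficient, one of least rank contributes a basis element that no other term contains.
\<close>

lemma std_monomials_independent:
  assumes zero: "(\<Sum>\<sigma>\<in>PB \<alpha>. scal (c \<sigma>) (free_hom \<alpha> \<nu> (std_monomial \<alpha> \<sigma>))) = 0"
    and \<sigma>: "\<sigma> \<in> PB \<alpha>"
  shows "c \<sigma> = 0"
proof (rule ccontr)
  assume "c \<sigma> \<noteq> 0"
  then obtain \<rho> where \<rho>: "\<rho> \<in> PB \<alpha>" "c \<rho> \<noteq> 0"
    and min: "\<And>\<tau>. \<tau> \<in> PB \<alpha> \<Longrightarrow> c \<tau> \<noteq> 0 \<Longrightarrow> rk \<rho> \<le> rk \<tau>"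
    using ex_has_least_nat[of "\<lambda>\<tau>. \<tau> \<in> PB \<alpha> \<and> c \<tau> \<noteq> 0" \<sigma> rk] \<sigma> by blast
  have coeff: "c \<tau> * Poly_Mapping.lookup (free_hom \<alpha> \<nu> (std_monomial \<alpha> \<tau>)) \<rho> = (if \<tau> = \<rho> then c \<rho> else 0)"
    if \<tau>: "\<tau> \<in> PB \<alpha>" for \<tau>
  proof (cases "c \<tau> = 0")
    case True
    then show ?thesis using \<rho> by auto
  next
    case False
    have "Poly_Mapping.lookup (free_hom \<alpha> \<nu> (std_monomial \<alpha> \<tau>) - Xi \<tau>) \<rho> = 0"
      using free_hom_std_monomial[OF \<tau>, of \<nu>] min[OF \<tau> False] by (auto simp: rk_ge_def)
    then show ?thesis
      by (simp add: lookup_minus lookup_Xi)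
  qed
  have "0 = (\<Sum>\<tau>\<in>PB \<alpha>. c \<tau> * Poly_Mapping.lookup (free_hom \<alpha> \<nu> (std_monomial \<alpha> \<tau>)) \<rho>)"
    using arg_cong[OF zero, of "\<lambda>p. Poly_Mapping.lookup p \<rho>"] by (simp add: lookup_sum)
  also have "\<dots> = c \<rho>"
    using \<rho>(1) by (simp add: coeff)
  finally show False
    using \<rho>(2) by simp
qed

lemma free_hom_kernel:
  assumes p: "p \<in> Fr \<alpha>" and "free_hom \<alpha> \<nu> p = 0"
  shows "p \<in> rel_ideal \<alpha> \<nu>"
proof -
  obtain c where c: "p - (\<Sum>\<sigma>\<in>PB \<alpha>. scal (c \<sigma>) (std_monomial \<alpha> \<sigma>)) \<in> rel_ideal \<alpha> \<nu>"
    using free_carrier_std_span[OF p] by (auto simp: std_span_def)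
  have "(\<Sum>\<sigma>\<in>PB \<alpha>. scal (c \<sigma>) (free_hom \<alpha> \<nu> (std_monomial \<alpha> \<sigma>))) = 0"
    using free_hom_rel_ideal[OF c] assms(2) by (simp add: free_hom_diff free_hom_sum free_hom_scal)
  then have "c \<sigma> = 0" if "\<sigma> \<in> PB \<alpha>" for \<sigma>
    using that by (rule std_monomials_independent)
  then show ?thesis
    using c by simp
qed

section \<open>The isomorphism\<close>

lemma a_kernel_free_hom:
  "a_kernel (free_alg (gens \<alpha>)) (O_alg \<alpha> \<nu>) (free_hom \<alpha> \<nu>) = rel_ideal \<alpha> \<nu>"
  unfolding a_kernel_def' free_alg_simps O_alg_simps
  using free_hom_kernel[of _ \<alpha> \<nu>] free_hom_rel_ideal[of _ \<alpha> \<nu>] rel_ideal_carrier[of _ \<alpha> \<nu>] by blast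

lemma Ot_alg_simps:
  "carrier (Ot_alg \<alpha> \<nu>) = carrier (free_alg (gens \<alpha>) Quot rel_ideal \<alpha> \<nu>)"
  "monoid.mult (Ot_alg \<alpha> \<nu>) = monoid.mult (free_alg (gens \<alpha>) Quot rel_ideal \<alpha> \<nu>)"
  "monoid.one (Ot_alg \<alpha> \<nu>) = monoid.one (free_alg (gens \<alpha>) Quot rel_ideal \<alpha> \<nu>)"
  "ring.add (Ot_alg \<alpha> \<nu>) = ring.add (free_alg (gens \<alpha>) Quot rel_ideal \<alpha> \<nu>)"
  by (simp_all add: Ot_alg_def quot_alg_def ring.defs)

abbreviation coset :: "nat \<Rightarrow> complex \<Rightarrow> (gen word \<Rightarrow>\<^sub>0 complex) \<Rightarrow> (gen word \<Rightarrow>\<^sub>0 complex) set" where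
  "coset \<alpha> \<nu> p \<equiv> rel_ideal \<alpha> \<nu> +>\<^bsub>free_alg (gens \<alpha>)\<^esub> p"

lemma coset_eq: "coset \<alpha> \<nu> p = {q. q - p \<in> rel_ideal \<alpha> \<nu>}"
proof -
  have "q \<in> coset \<alpha> \<nu> p \<longleftrightarrow> q - p \<in> rel_ideal \<alpha> \<nu>" for q
    by (auto simp: a_r_coset_def' intro!: bexI[of _ "q - p"])
  then show ?thesis
    by blast
qed

lemma coset_cong: "p - q \<in> rel_ideal \<alpha> \<nu> \<Longrightarrow> coset \<alpha> \<nu> p = coset \<alpha> \<nu> q"
proof -
  assume pq: "p - q \<in> rel_ideal \<alpha> \<nu>"
  have "r - p \<in> rel_ideal \<alpha> \<nu> \<longleftrightarrow> r - q \<in> rel_ideal \<alpha> \<nu>" for r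
    using rel_ideal_add[OF _ pq, of "r - p"] rel_ideal_diff[OF _ pq, of "r - q"] by auto
  then show ?thesis
    by (simp add: coset_eq)
qed

lemma carrier_Ot_alg: "carrier (Ot_alg \<alpha> \<nu>) = coset \<alpha> \<nu> ` Fr \<alpha>"
  unfolding Ot_alg_simps(1) FactRing_def partial_object.simps A_RCOSETS_def' free_alg_simps by blast

text \<open>
  The scalar multiple of a coset is defined as a union over its elements, all of which give the same coset.
\<close>

lemma smult_Ot_alg:
  "c \<odot>\<^bsub>Ot_alg \<alpha> \<nu>\<^esub> coset \<alpha> \<nu> p = coset \<alpha> \<nu> (scal c p)"
proof -
  have "c \<odot>\<^bsub>Ot_alg \<alpha> \<nu>\<^esub> coset \<alpha> \<nu> p = (\<Union>q\<in>coset \<alpha> \<nu> p. coset \<alpha> \<nu> (scal c q))"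
    by (simp add: Ot_alg_def quot_alg_def ring.defs module.defs)
  also have "\<dots> = (\<Union>q\<in>coset \<alpha> \<nu> p. coset \<alpha> \<nu> (scal c p))"
  proof (intro SUP_cong refl coset_cong)
    fix q assume "q \<in> coset \<alpha> \<nu> p"
    then have "scal c (q - p) \<in> rel_ideal \<alpha> \<nu>"
      by (intro rel_ideal_scal) (simp add: coset_eq)
    then show "scal c q - scal c p \<in> rel_ideal \<alpha> \<nu>"
      by (simp add: scal_diff)
  qed
  also have "\<dots> = coset \<alpha> \<nu> (scal c p)"
  proof -
    have "p \<in> coset \<alpha> \<nu> p"
      by (simp add: coset_eq rel_ideal_0)
    then show ?thesis
      by blast
  qed
  finally show ?thesis .
qed

definition Ot_iso :: "nat \<Rightarrow> complex \<Rightarrow> (gen word \<Rightarrow>\<^sub>0 complex) set \<Rightarrow> (pbij \<Rightarrow>\<^sub>0 complex)" where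
  "Ot_iso \<alpha> \<nu> X = the_elem (free_hom \<alpha> \<nu> ` X)"

lemma Ot_iso_coset: "p \<in> Fr \<alpha> \<Longrightarrow> Ot_iso \<alpha> \<nu> (coset \<alpha> \<nu> p) = free_hom \<alpha> \<nu> p"
  using ring_hom_ring.the_elem_simp[OF ring_hom_ring_free_hom, of p \<alpha> \<nu>]
  by (simp add: Ot_iso_def a_kernel_free_hom)

lemma Ot_iso_alg_iso: "Ot_iso \<alpha> \<nu> \<in> alg_iso (Ot_alg \<alpha> \<nu>) (O_alg \<alpha> \<nu>)"
proof -
  have "Ot_iso \<alpha> \<nu> \<in> ring_iso (free_alg (gens \<alpha>) Quot rel_ideal \<alpha> \<nu>) (O_alg \<alpha> \<nu>)"
    using ring_hom_ring.FactRing_iso_set[OF ring_hom_ring_free_hom, of \<alpha> \<nu>]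
    unfolding a_kernel_free_hom by (simp add: free_hom_surj Ot_iso_def[abs_def])
  then have iso: "Ot_iso \<alpha> \<nu> \<in> ring_iso (Ot_alg \<alpha> \<nu>) (O_alg \<alpha> \<nu>)"
    by (simp add: ring_iso_def ring_hom_def Ot_alg_simps)
  have "Ot_iso \<alpha> \<nu> (c \<odot>\<^bsub>Ot_alg \<alpha> \<nu>\<^esub> x) = scal c (Ot_iso \<alpha> \<nu> x)" if "x \<in> carrier (Ot_alg \<alpha> \<nu>)" for c x
    using that by (auto simp: carrier_Ot_alg smult_Ot_alg Ot_iso_coset free_carrier_scal free_hom_scal)
  with iso show ?thesis
    by (simp add: alg_iso_def alg_hom_def ring_iso_def)
qed

lemma maps_gens_Ot_iso: "maps_gens \<alpha> \<nu> (Ot_iso \<alpha> \<nu>)"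
  by (simp add: maps_gens_def A_gen_def Theta_gen_def Ot_iso_coset free_carrier_gen free_hom_gen)

text \<open>
  This gives uniqueness: the composition with the quotient map is multiplicative and linear, so it is determined by
  its values on the generators.
\<close>

lemma alg_hom_eq_free_hom:
  assumes \<psi>: "\<psi> \<in> alg_hom (Ot_alg \<alpha> \<nu>) (O_alg \<alpha> \<nu>)" and gens: "maps_gens \<alpha> \<nu> \<psi>" and p: "p \<in> Fr \<alpha>"
  shows "\<psi> (coset \<alpha> \<nu> p) = free_hom \<alpha> \<nu> p"
proof -
  let ?\<pi> = "\<lambda>p. \<psi> (coset \<alpha> \<nu> p)"
  note quot = ideal.rcos_ring_hom[OF ideal_rel_ideal[of \<alpha> \<nu>]]
  have hom: "\<psi> \<in> ring_hom (Ot_alg \<alpha> \<nu>) (O_alg \<alpha> \<nu>)"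
    using \<psi> by (simp add: alg_hom_def)
  have mult: "?\<pi> (q * r) = O_mult \<alpha> \<nu> (?\<pi> q) (?\<pi> r)" if "q \<in> Fr \<alpha>" "r \<in> Fr \<alpha>" for q r
    using ring_hom_mult[OF hom, of "coset \<alpha> \<nu> q" "coset \<alpha> \<nu> r"] ring_hom_mult[OF quot, of q r] that
    by (simp add: carrier_Ot_alg Ot_alg_simps)
  have add: "?\<pi> (q + r) = ?\<pi> q + ?\<pi> r" if "q \<in> Fr \<alpha>" "r \<in> Fr \<alpha>" for q r
    using ring_hom_add[OF hom, of "coset \<alpha> \<nu> q" "coset \<alpha> \<nu> r"] ring_hom_add[OF quot, of q r] that
    by (simp add: carrier_Ot_alg Ot_alg_simps)
  have one: "?\<pi> 1 = Xi (perm_pb \<alpha> id)"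
    using ring_hom_one[OF hom] ring_hom_one[OF quot] by (simp add: Ot_alg_simps)
  have scal: "?\<pi> (scal c q) = scal c (?\<pi> q)" if "q \<in> Fr \<alpha>" for c q
    using \<psi> that by (simp add: alg_hom_def carrier_Ot_alg flip: smult_Ot_alg)
  have gen: "?\<pi> (free_gen x) = gen_image \<alpha> x" if "x \<in> gens \<alpha>" for x
    using that gens by (cases x) (simp_all add: maps_gens_def A_gen_def Theta_gen_def)
  have word_carrier: "Poly_Mapping.single (Word xs) 1 \<in> Fr \<alpha>" if "set xs \<subseteq> gens \<alpha>" for xs
    using that by (simp add: free_carrier_def)
  have word: "?\<pi> (Poly_Mapping.single (Word xs) 1) = word_image \<alpha> \<nu> xs" if "set xs \<subseteq> gens \<alpha>" for xs
    using that
  proof (induction xs)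
    case Nil
    show ?case
      using one by (simp flip: zero_word_def)
  next
    case (Cons x xs)
    then show ?case
      unfolding single_word_Cons by (simp add: mult free_carrier_gen word_carrier gen)
  qed
  have single_carrier: "Poly_Mapping.single w c \<in> Fr \<alpha>" if "set (letters w) \<subseteq> gens \<alpha>" for w c
    using that by (simp add: free_carrier_def)
  have single: "?\<pi> (Poly_Mapping.single w c) = free_hom \<alpha> \<nu> (Poly_Mapping.single w c)"
    if "set (letters w) \<subseteq> gens \<alpha>" for w c
    using scal[OF word_carrier[OF that], of c] word[OF that] by (simp add: scal_single free_hom_single)
  have zero: "?\<pi> 0 = 0"
    using scal[OF free_carrier_0, of 0] by simp
  have sums: "?\<pi> (\<Sum>w\<in>K. Poly_Mapping.single w (f w)) = free_hom \<alpha> \<nu> (\<Sum>w\<in>K. Poly_Mapping.single w (f w))"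
    if "finite K" "\<forall>w\<in>K. set (letters w) \<subseteq> gens \<alpha>" for K f
    using that
    by (induction K rule: finite_induct)
      (simp_all add: zero add single single_carrier free_carrier_sum free_hom_add)
  have "?\<pi> (\<Sum>w\<in>Poly_Mapping.keys p. Poly_Mapping.single w (Poly_Mapping.lookup p w))
      = free_hom \<alpha> \<nu> (\<Sum>w\<in>Poly_Mapping.keys p. Poly_Mapping.single w (Poly_Mapping.lookup p w))"
    using p by (intro sums) (simp_all add: free_carrier_def)
  then show ?thesis
    by (simp only: sum_single_keys[OF finite_keys order_refl, symmetric])
qed

theorem theorem4p1:
  fixes \<alpha> :: nat and \<nu> :: complex
  shows "\<exists>\<phi> \<in> alg_iso (Ot_alg \<alpha> \<nu>) (O_alg \<alpha> \<nu>). maps_gens \<alpha> \<nu> \<phi> \<and>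
    (\<forall>\<psi> \<in> alg_hom (Ot_alg \<alpha> \<nu>) (O_alg \<alpha> \<nu>). maps_gens \<alpha> \<nu> \<psi> \<longrightarrow>
       (\<forall>x \<in> carrier (Ot_alg \<alpha> \<nu>). \<psi> x = \<phi> x))"
proof (intro bexI[OF _ Ot_iso_alg_iso] conjI maps_gens_Ot_iso ballI impI)
  fix \<psi> x
  assume \<psi>: "\<psi> \<in> alg_hom (Ot_alg \<alpha> \<nu>) (O_alg \<alpha> \<nu>)" "maps_gens \<alpha> \<nu> \<psi>" and "x \<in> carrier (Ot_alg \<alpha> \<nu>)"
  then obtain p where "p \<in> Fr \<alpha>" "x = coset \<alpha> \<nu> p"
    by (auto simp: carrier_Ot_alg)
  then show "\<psi> x = Ot_iso \<alpha> \<nu> x"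
    using alg_hom_eq_free_hom[OF \<psi>] Ot_iso_coset by simp
qed

end
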